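(* Let $n\ge 2$ and let $\pi:\mathrm{SO}_0(1,n)\to\mathbb{H}^n$ be the Riemannian submersion described in the context, with $\bar e=\pi(e)$. Let $S\subset\mathbb{H}^n$ be a smooth disk (a smooth embedded surface with boundary, diffeomorphic to the closed disk $D^2$) with $\bar e\in\partial S$. Let $\gamma:[0,1]\to\partial S$ be the boundary curve of $S$, a loop based at $\bar e$ traversing $\partial S$ once in a given direction, and let $\tilde\gamma:[0,1]\to\mathrm{SO}_0(1,n)$ be its horizontal lift with $\tilde\gamma(0)=e$. Then there exists a $C^1$ curve $f:[0,1]\to\mathrm{SO}(n)\subset\mathrm{SO}_0(1,n)$ with $f(0)=e$ such that (i) $f(1)=f(0)^{-1}f(1)=\tilde\gamma(0)^{-1}\tilde\gamma(1)$, i.e. $f(1)$ is the holonomy displacement (the difference in the sense of right multiplication) induced by the boundary of $S$; and (ii) the length of the curve $f$ equals the area of $S$.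
   Context: $\mathrm{O}(1,n)=\{A\in \mathrm{GL}(n+1;\mathbb{R}) : A^tSA=S\}$ with $S=\mathrm{diag}(-1,1,\dots,1)$ (this matrix is unrelated to the disk $S$ of the claim); $\mathrm{SO}_0(1,n)$ is its identity component, with identity $e$ and Lie algebra $\mathfrak{so}(1,n)$. $\mathrm{SO}(n)$ is regarded as the subgroup of $\mathrm{SO}_0(1,n)$ of matrices $\begin{pmatrix}1&0\\0&B\end{pmatrix}$, $B\in \mathrm{SO}(n)$ (the usual special orthogonal group). $\mathrm{SO}_0(1,n)$ carries the left-invariant Riemannian metric induced by the inner product $\langle A,B\rangle=\tfrac12\mathrm{trace}(A^tB)$ on $\mathfrak{so}(1,n)$. Right translations by elements of $\mathrm{SO}(n)$ are isometries, and the quotient $\mathrm{SO}_0(1,n)/\mathrm{SO}(n)$ with the quotient metric is isometric to hyperbolic space $\mathbb{H}^n$ (constant curvature $-1$); $\pi:\mathrm{SO}_0(1,n)\to \mathrm{SO}_0(1,n)/\mathrm{SO}(n)=\mathbb{H}^n$ is the quotient map. It is a Riemannian submersion and a principal $\mathrm{SO}(n)$-bundle. The horizontal space at $g\in\mathrm{SO}_0(1,n)$ is the orthogonal complement of the tangent space of the fiber $g\,\mathrm{SO}(n)$, i.e. the left translate by $g$ of $\mathfrak{so}(n)^\perp\subset\mathfrak{so}(1,n)$. A horizontal lift of a curve in $\mathbb{H}^n$ is a curve in $\mathrm{SO}_0(1,n)$ projecting to it under $\pi$ with velocity everywhere horizontal. Length in $\mathrm{SO}(n)$ is measured with the restriction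 to $\mathrm{SO}(n)$ of the left-invariant Riemannian metric on $\mathrm{SO}_0(1,n)$ induced by the inner product $\langle A,B\rangle=\tfrac12\mathrm{trace}(A^tB)$ on $\mathfrak{so}(1,n)$, and area of $S$ with the metric induced from $\mathbb{H}^n$. *)

theory Defs
  imports "HOL-Analysis.Analysis"
begin

text \<open>
  Square matrices of size \<open>n + 1\<close> are indexed by \<open>'n option\<close> with \<open>n = CARD('n)\<close>: the index \<open>None\<close>
  is the time coordinate, \<open>Some i\<close> are the \<open>n\<close> space coordinates.
\<close>

definition lorentz :: "real^('n::finite option)^('n option)" where
  "lorentz = (\<chi> i j. if i = j then (if i = None then -1 else 1) else 0)"

definition O1n :: "(real^('n::finite option)^('n option)) set" where
  "O1n = {A. invertible A \<and> transpose A ** lorentz ** A = lorentz}"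

definition SO1n :: "(real^('n::finite option)^('n option)) set" where
  "SO1n = connected_component_set O1n (mat 1)"

definition block :: "real \<Rightarrow> real^'n^'n \<Rightarrow> real^('n::finite option)^('n option)" where
  "block a B = (\<chi> i j. case (i, j) of
     (None, None) \<Rightarrow> a | (Some k, Some l) \<Rightarrow> B $ k $ l | _ \<Rightarrow> 0)"

definition SOn :: "(real^('n::finite option)^('n option)) set" where
  "SOn = {block 1 B | B. rotation_matrix B}"

definition so1n :: "(real^('n::finite option)^('n option)) set" where
  "so1n = {A. transpose A ** lorentz + lorentz ** A = 0}"

definition son :: "(real^('n::finite option)^('n option)) set" where
  "son = {block 0 B | B. transpose B = - B}"

definition lie_inner :: "real^'m^'m \<Rightarrow> real^'m^'m \<Rightarrow> real" where
  "lie_inner A B = trace (transpose A ** B) / 2"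

definition left_inner :: "real^'m^'m \<Rightarrow> real^'m^'m \<Rightarrow> real^'m^'m \<Rightarrow> real" where
  "left_inner g V W = lie_inner (matrix_inv g ** V) (matrix_inv g ** W)"

definition horizontal_space ::
  "real^('n::finite option)^('n option) \<Rightarrow> (real^('n option)^('n option)) set" where
  "horizontal_space g = (\<lambda>A. g ** A) ` {A \<in> so1n. \<forall>B\<in>son. lie_inner A B = 0}"

text \<open>
  The quotient \<open>SO\<^sub>0(1,n)/SO(n)\<close> is realised as the orbit of the first basis vector, which is the
  hyperboloid model of hyperbolic space; its Riemannian metric is the restriction of the Minkowski
  form to tangent spaces. The lemmas at the end of this theory justify the identification: \<open>proj\<close>
  maps \<open>SO\<^sub>0(1,n)\<close> onto the hyperboloid, its fibres are the cosets \<open>g SO(n)\<close>, and its derivative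
  (it is linear in \<open>g\<close>) maps each horizontal space isometrically onto the tangent space, so that the
  Minkowski metric is the quotient metric.
\<close>

definition minkowski :: "real^('n::finite option) \<Rightarrow> real^('n option) \<Rightarrow> real" where
  "minkowski x y = x \<bullet> (lorentz *v y)"

definition hyperbolic_space :: "(real^('n::finite option)) set" where
  "hyperbolic_space = {x. minkowski x x = -1 \<and> x $ None > 0}"

definition proj :: "real^('n::finite option)^('n option) \<Rightarrow> real^('n option)" where
  "proj g = g *v axis None 1"

definition C1_curve :: "(real \<Rightarrow> 'a::real_normed_vector) \<Rightarrow> bool" where
  "C1_curve c \<longleftrightarrow> (\<exists>c'. continuous_on {0..1} c' \<and>
     (\<forall>t\<in>{0..1}. (c has_vector_derivative c' t) (at t within {0..1})))"

definition horizontal_lift ::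
  "(real \<Rightarrow> real^('n::finite option)^('n option)) \<Rightarrow> (real \<Rightarrow> real^('n option)) \<Rightarrow> bool" where
  "horizontal_lift c \<gamma> \<longleftrightarrow> (\<forall>t\<in>{0..1}. c t \<in> SO1n \<and> proj (c t) = \<gamma> t \<and>
     (\<exists>V\<in>horizontal_space (c t). (c has_vector_derivative V) (at t within {0..1})))"

definition curve_length :: "(real \<Rightarrow> real^'m^'m) \<Rightarrow> real" where
  "curve_length c = integral {0..1} (\<lambda>t.
     let V = vector_derivative c (at t within {0..1}) in sqrt (left_inner (c t) V V))"

text \<open>\<open>Ck_on\<close> is meant for open sets \<open>U\<close> in a finite-dimensional domain.\<close>

primrec Ck_on :: "nat \<Rightarrow> ('a::euclidean_space \<Rightarrow> 'b::real_normed_vector) \<Rightarrow> 'a set \<Rightarrow> bool" where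
  "Ck_on 0 f U \<longleftrightarrow> continuous_on U f"
| "Ck_on (Suc k) f U \<longleftrightarrow> (\<forall>x\<in>U. f differentiable at x) \<and>
     (\<forall>v. Ck_on k (\<lambda>x. frechet_derivative f (at x) v) U)"

definition smooth_on :: "('a::euclidean_space \<Rightarrow> 'b::real_normed_vector) \<Rightarrow> 'a set \<Rightarrow> bool" where
  "smooth_on f U \<longleftrightarrow> (\<forall>k. Ck_on k f U)"

text \<open>
  \<open>\<phi>\<close> is a diffeomorphism from the closed unit disk onto the embedded surface \<open>S\<close>. As usual,
  smoothness up to the boundary is smoothness of an extension to an open neighbourhood of the disk;
  the extension is \<open>\<phi>\<close> itself, and only its restriction to the disk has to take values in \<open>S\<close>.
  An injective immersion of the (compact) disk is an embedding.
\<close>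

definition disk_diffeo :: "(real^2 \<Rightarrow> 'a::euclidean_space) \<Rightarrow> 'a set \<Rightarrow> bool" where
  "disk_diffeo \<phi> S \<longleftrightarrow>
     (\<exists>U. open U \<and> cball 0 1 \<subseteq> U \<and> smooth_on \<phi> U) \<and>
     bij_betw \<phi> (cball 0 1) S \<and>
     (\<forall>p\<in>cball 0 1. inj (frechet_derivative \<phi> (at p)))"

text \<open>
  The area of \<open>\<phi> ` cball 0 1\<close>, computed in the coordinates \<open>\<phi>\<close> as the integral of the square root
  of the Gram determinant of the induced metric.
\<close>

definition disk_area :: "(real^2 \<Rightarrow> real^('n::finite option)) \<Rightarrow> real" where
  "disk_area \<phi> = integral (cball 0 1) (\<lambda>p.
     let u = frechet_derivative \<phi> (at p) (axis 1 1);
         v = frechet_derivative \<phi> (at p) (axis 2 1)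
     in sqrt (minkowski u u * minkowski v v - (minkowski u v)\<^sup>2))"


subsection \<open>Justification of the model of the quotient\<close>

lemma sum_option: "(\<Sum>i\<in>UNIV. f i) = f None + (\<Sum>i\<in>UNIV. f (Some (i::'n::finite)))"
  by (simp add: UNIV_option_conv sum.reindex)

lemma lorentz_mult:
  "(lorentz *v x) $ i = (if i = None then - (x $ None) else x $ i)"
proof -
  have "(lorentz *v x) $ i = (\<Sum>j\<in>UNIV. if i = j then (if i = None then -1 else 1) * x $ j else 0)"
    unfolding matrix_vector_mult_def lorentz_def vec_lambda_beta by (intro sum.cong) auto
  then show ?thesis by simp
qed

lemma minkowski_eq:
  "minkowski x y = - (x $ None * y $ None) + (\<Sum>i\<in>UNIV. x $ Some i * y $ Some i)"
  by (simp add: minkowski_def inner_vec_def sum_option lorentz_mult)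

lemma lorentz_lorentz: "lorentz ** lorentz = (mat 1 :: real^('n::finite option)^('n option))"
  by (simp add: matrix_eq matrix_vector_mul_assoc[symmetric] vec_eq_iff lorentz_mult)

lemma O1n_iff: "A \<in> O1n \<longleftrightarrow> transpose A ** lorentz ** A = lorentz"
proof -
  have "invertible A" if "transpose A ** lorentz ** A = lorentz"
  proof -
    have "(lorentz ** transpose A ** lorentz) ** A = mat 1"
      by (metis that lorentz_lorentz matrix_mul_assoc)
    then show ?thesis
      using invertible_left_inverse by blast
  qed
  then show ?thesis
    by (auto simp: O1n_def)
qed

lemma minkowski_O1n:
  assumes "A \<in> O1n"
  shows "minkowski (A *v x) (A *v y) = minkowski x y"
proof -
  have "minkowski (A *v x) (A *v y) = x \<bullet> ((transpose A ** lorentz ** A) *v y)"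
    unfolding minkowski_def
    by (metis dot_lmul_matrix vector_transpose_matrix matrix_vector_mul_assoc)
  also have "\<dots> = minkowski x y"
    using assms by (simp add: O1n_def minkowski_def)
  finally show ?thesis .
qed

lemma mat1_O1n: "mat 1 \<in> O1n"
  by (simp add: O1n_iff)

lemma SO1n_subset: "SO1n \<subseteq> O1n"
  by (simp add: SO1n_def connected_component_subset)

lemma SO1n_I:
  assumes "connected T" "mat 1 \<in> T" "T \<subseteq> O1n" "A \<in> T"
  shows "A \<in> SO1n"
  using connected_component_maximal[OF assms(2,1,3)] assms(4) by (auto simp: SO1n_def)

lemma pos_on_SO1n:
  fixes f :: "real^('n::finite option)^('n option) \<Rightarrow> real"
  assumes "continuous_on UNIV f" "f (mat 1) > 0" "\<And>A. A \<in> O1n \<Longrightarrow> f A \<noteq> 0" "A \<in> SO1n"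
  shows "f A > 0"
proof (rule ccontr)
  assume neg: "\<not> f A > 0"
  have "connected (f ` SO1n)"
    unfolding SO1n_def
    by (intro connected_continuous_image connected_connected_component
        continuous_on_subset[OF assms(1)]) auto
  moreover have "f A \<in> f ` SO1n" "f (mat 1) \<in> f ` SO1n"
    using assms(4) mat1_O1n by (auto simp: SO1n_def)
  ultimately have "0 \<in> f ` SO1n"
    using neg assms(2) by (meson connectedD_interval less_imp_le linorder_not_less)
  then show False
    using assms(3) SO1n_subset by force
qed

lemma proj_nth: "proj A $ i = A $ i $ None"
  by (simp add: proj_def matrix_vector_mul_component inner_axis)

lemma minkowski_proj:
  assumes "A \<in> O1n"
  shows "minkowski (proj A) (proj A) = -1"
  unfolding proj_def using minkowski_O1n[OF assms]
  by (simp add: minkowski_eq axis_def)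

lemma proj_SO1n:
  fixes A :: "real^('n::finite option)^('n option)"
  assumes "A \<in> SO1n"
  shows "proj A \<in> hyperbolic_space"
proof -
  have "A $ None $ None > 0"
  proof (rule pos_on_SO1n[OF _ _ _ assms])
    show "continuous_on UNIV (\<lambda>A::real^('n option)^('n option). A $ None $ None)"
      by (intro continuous_intros)
    show "A $ None $ None \<noteq> 0" if "A \<in> O1n" for A :: "real^('n option)^('n option)"
      using minkowski_proj[OF that] sum_nonneg[of UNIV "\<lambda>i. A $ Some i $ None * A $ Some i $ None"]
      by (auto simp: minkowski_eq proj_nth)
  qed (simp add: mat_def)
  then show ?thesis
    using minkowski_proj[of A] assms SO1n_subset by (auto simp: hyperbolic_space_def proj_nth)
qed

lemma det_SO1n:
  fixes A :: "real^('n::finite option)^('n option)"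
  assumes "A \<in> SO1n"
  shows "det A = 1"
proof -
  have sq: "det A * det A = 1" if "A \<in> O1n" for A :: "real^('n option)^('n option)"
  proof -
    have "det (lorentz::real^('n option)^('n option)) \<noteq> 0"
      using invertible_det_nz invertible_left_inverse lorentz_lorentz by blast
    moreover have "det A * det (lorentz::real^('n option)^('n option)) * det A = det (lorentz::real^('n option)^('n option))"
      using arg_cong[OF that[unfolded O1n_iff], of det]
      by (simp only: det_mul det_transpose)
    ultimately show ?thesis
      by (simp add: mult.commute[of _ "det lorentz"] mult.assoc)
  qed
  have "det A > 0"
  proof (rule pos_on_SO1n[OF _ _ _ assms])
    show "continuous_on UNIV (det :: real^('n option)^('n option) \<Rightarrow> real)"
      unfolding det_def
      by (intro continuous_on_sum continuous_on_mult continuous_on_const continuous_on_prod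
          continuous_on_component continuous_on_id)
    show "det A \<noteq> 0" if "A \<in> O1n" for A :: "real^('n option)^('n option)"
      using sq[OF that] by auto
  qed simp
  moreover have "det A * det A = 1"
    using sq assms SO1n_subset by blast
  ultimately show ?thesis
    by (simp add: square_eq_1_iff)
qed

definition boost :: "real^('n::finite option) \<Rightarrow> real^('n option)^('n option)" where
  "boost x = (\<chi> i j. case (i, j) of
     (None, None) \<Rightarrow> x $ None | (None, Some l) \<Rightarrow> x $ Some l | (Some k, None) \<Rightarrow> x $ Some k
   | (Some k, Some l) \<Rightarrow> (if k = l then 1 else 0) + x $ Some k * x $ Some l / (1 + x $ None))"

lemma transpose_mult_nth: "(transpose A ** C) $ i $ j = (\<Sum>k\<in>UNIV. A $ k $ i * C $ k $ j)"
  by (simp add: matrix_matrix_mult_def transpose_def)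

lemma lorentz_mult_matrix: "(lorentz ** A) $ k $ j = (if k = None then - (A $ None $ j) else A $ k $ j)"
  using lorentz_mult[of "column j A" k]
  by (simp add: matrix_matrix_mult_def matrix_vector_mult_def column_def)

lemma O1n_component_iff:
  "A \<in> O1n \<longleftrightarrow> (\<forall>i j. - (A $ None $ i * A $ None $ j) + (\<Sum>k\<in>UNIV. A $ Some k $ i * A $ Some k $ j)
     = (if i = j then (if i = None then -1 else 1) else 0))"
proof -
  have *: "(transpose A ** lorentz ** A) $ i $ j =
      - (A $ None $ i * A $ None $ j) + (\<Sum>k\<in>UNIV. A $ Some k $ i * A $ Some k $ j)" for i j
  proof -
    have "(transpose A ** lorentz ** A) $ i $ j = (\<Sum>k\<in>UNIV. A $ k $ i * (lorentz ** A) $ k $ j)"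
      by (simp only: matrix_mul_assoc[symmetric] transpose_mult_nth)
    then show ?thesis by (simp add: lorentz_mult_matrix sum_option)
  qed
  then show ?thesis
    unfolding O1n_iff vec_eq_iff * by (simp add: lorentz_def)
qed

lemma boost_O1n:
  fixes x :: "real^('n::finite option)"
  assumes "x \<in> hyperbolic_space"
  shows "boost x \<in> O1n"
proof -
  define t where "t = x $ None"
  define a where "a k = x $ Some k" for k
  have t: "t > 0" and s: "(\<Sum>k\<in>UNIV. a k * a k) = t * t - 1"
    using assms by (auto simp: hyperbolic_space_def minkowski_eq t_def a_def)
  have sc: "(\<Sum>k\<in>UNIV. a k * a k * c) = (t * t - 1) * c" for c
    by (simp only: sum_distrib_right[symmetric] s)
  have "(\<Sum>k\<in>UNIV. a k * ((if k = l then 1 else 0) + a k * a l / (1 + t))) = t * a l" for l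
  proof -
    have "(\<Sum>k\<in>UNIV. a k * ((if k = l then 1 else 0) + a k * a l / (1 + t)))
        = (\<Sum>k\<in>UNIV. (if k = l then a k else 0) + a k * a k * (a l / (1 + t)))"
      by (intro sum.cong) (auto simp: algebra_simps)
    also have "\<dots> = a l + (t * t - 1) * (a l / (1 + t))"
      by (simp only: sum.distrib sc) simp
    also have "\<dots> = t * a l"
      using t by (simp add: field_simps)
    finally show ?thesis .
  qed
  moreover have "(\<Sum>k\<in>UNIV. ((if k = l then 1 else 0) + a k * a l / (1 + t)) *
      ((if k = m then 1 else 0) + a k * a m / (1 + t))) = (if l = m then 1 else 0) + a l * a m" for l m
  proof -
    have "(\<Sum>k\<in>UNIV. ((if k = l then 1 else 0) + a k * a l / (1 + t)) *
        ((if k = m then 1 else 0) + a k * a m / (1 + t)))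
        = (\<Sum>k\<in>UNIV. (if k = l then (if l = m then 1 else 0) else 0)
           + (if k = l then a k * a m / (1 + t) else 0) + (if k = m then a k * a l / (1 + t) else 0)
           + a k * a k * (a l * a m / (1 + t)\<^sup>2))"
      by (intro sum.cong) (auto simp: algebra_simps power2_eq_square)
    also have "\<dots> = (if l = m then 1 else 0) + 2 * (a l * a m / (1 + t)) +
        (t * t - 1) * (a l * a m / (1 + t)\<^sup>2)"
      by (simp only: sum.distrib sc) simp
    also have "\<dots> = (if l = m then 1 else 0) + a l * a m"
    proof -
      have "t * t - 1 = (t - 1) * (1 + t)" by (simp add: algebra_simps)
      then have "(t * t - 1) * (a l * a m / (1 + t)\<^sup>2) = (t - 1) * (a l * a m / (1 + t))"
        using t by (simp add: power2_eq_square)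
      then have "2 * (a l * a m / (1 + t)) + (t * t - 1) * (a l * a m / (1 + t)\<^sup>2)
          = 2 * (a l * a m / (1 + t)) + (t - 1) * (a l * a m / (1 + t))"
        by (simp only:)
      also have "\<dots> = (1 + t) * (a l * a m / (1 + t))"
        by (simp only: distrib_right[symmetric]) (simp add: algebra_simps)
      also have "\<dots> = a l * a m" using t by simp
      finally show ?thesis by simp
    qed
    finally show ?thesis .
  qed
  ultimately show ?thesis
    using s unfolding O1n_component_iff
    by (auto simp: boost_def mult.commute split: option.split simp flip: t_def a_def)
qed

lemma proj_boost: "proj (boost x) = x"
  by (auto simp: vec_eq_iff proj_nth boost_def split: option.split)

lemma boost_SO1n:
  fixes x :: "real^('n::finite option)"
  assumes "x \<in> hyperbolic_space"
  shows "boost x \<in> SO1n"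
proof -
  define s where "s = (\<Sum>k\<in>UNIV. x $ Some k * x $ Some k)"
  have s: "s \<ge> 0" by (auto simp: s_def intro: sum_nonneg)
  define y where "y t = (\<chi> i. case i of None \<Rightarrow> sqrt (1 + t\<^sup>2 * s) | Some k \<Rightarrow> t * x $ Some k)"
    for t :: real
  have pos: "1 + t\<^sup>2 * s > 0" for t
    using s by (simp add: add_pos_nonneg)
  have y: "y t \<in> hyperbolic_space" for t
    using pos[of t]
    by (simp add: hyperbolic_space_def minkowski_eq y_def s_def sum_distrib_left power2_eq_square
        mult_ac real_sqrt_mult_self)
  have cont: "continuous_on {0..1} (\<lambda>t. boost (y t))"
  proof -
    have "continuous_on {0..1} (\<lambda>t. boost (y t) $ i $ j)" for i j
      using pos by (cases i; cases j)
        (auto simp: boost_def y_def less_imp_neq add_pos_nonneg s intro!: continuous_intros, 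
          (smt (verit) pos real_sqrt_gt_zero)+)
    then show ?thesis
      by (auto simp: continuous_on_vec_lambda intro: continuous_on_vec_lambda[of _ "\<lambda>i t. boost (y t) $ i", simplified]
          continuous_on_vec_lambda[of _ "\<lambda>j t. boost (y t) $ i $ j" for i, simplified])
  qed
  have "y 1 = x"
  proof -
    have "1 + s = x $ None * x $ None" "x $ None > 0"
      using assms by (auto simp: hyperbolic_space_def minkowski_eq s_def)
    then show ?thesis
      by (auto simp: y_def vec_eq_iff split: option.split)
  qed
  moreover have "boost (y 0) = mat 1"
    by (auto simp: y_def boost_def mat_def vec_eq_iff split: option.split)
  ultimately show ?thesis
    using boost_O1n[OF y]
    by (intro SO1n_I[of "(\<lambda>t. boost (y t)) ` {0..1}"] connected_continuous_image cont)
       (auto simp: image_iff intro: bexI[of _ 0] bexI[of _ 1])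
qed

theorem proj_image_SO1n: "proj ` SO1n = hyperbolic_space"
  using proj_SO1n boost_SO1n proj_boost by (metis image_subset_iff subsetI subset_antisym rev_image_eqI)

lemma det_block:
  fixes B :: "real^'n^'n::finite"
  shows "det (block 1 B) = det B"
proof (rule induct_matrix_elementary[of "\<lambda>B. det (block 1 B) = det B"], goal_cases)
  case mult: (1 A B)
  have "block 1 (A ** B) = block 1 A ** block 1 B"
    by (auto simp: vec_eq_iff block_def matrix_matrix_mult_def sum_option split: option.split)
  then show ?case using mult by (simp add: det_mul)
next
  case zero_row: (2 A i)
  have "row (Some i) (block 1 A) = 0"
    using zero_row by (auto simp: vec_eq_iff row_def block_def split: option.split)
  then show ?case using zero_row by (metis det_zero_row(1))
next
  case diagonal: (3 A)
  have "det (block 1 A) = (\<Prod>i\<in>UNIV. block 1 A $ i $ i)"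
    using diagonal by (intro det_diagonal) (auto simp: block_def split: option.split)
  also have "\<dots> = (\<Prod>i\<in>UNIV. A $ i $ i)"
    by (simp add: UNIV_option_conv prod.reindex block_def)
  finally show ?case using diagonal by (simp add: det_diagonal)
next
  case swap1: (4 m n)
  have eq: "block 1 (\<chi> i j. mat 1 $ i $ Transposition.transpose m n j) =
      (\<chi> i j. mat 1 $ i $ Transposition.transpose (Some m) (Some n) j)"
    by (auto simp: vec_eq_iff block_def mat_def Transposition.transpose_def split: option.split)
  have "det ((\<chi> i j. mat 1 $ i $ Transposition.transpose a b j) :: real^'k^'k) = -1"
    if "a \<noteq> b" for a b :: "'k::finite"
    using det_permute_columns[OF permutes_swap_id[of a UNIV b], of "mat 1 :: real^'k^'k"] that
    by (simp add: sign_swap_id)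
  from this[OF swap1] this[of "Some m" "Some n"] show ?case
    using swap1 by (simp add: eq)
next
  case idplus: (5 m n c)
  have *: "det ((\<chi> i j. if i = a \<and> j = b then c else of_bool (i = j)) :: real^'k^'k) = 1"
    if "a \<noteq> b" for a b :: "'k::finite"
  proof -
    have "((\<chi> i j. if i = a \<and> j = b then c else of_bool (i = j)) :: real^'k^'k) =
        (\<chi> k. if k = a then row a (mat 1) + c *s row b (mat 1) else row k (mat 1))"
      using that by (auto simp: vec_eq_iff row_def mat_def)
    then show ?thesis using det_row_operation[OF that, of "mat 1" c] by simp
  qed
  have "block 1 (\<chi> i j. if i = m \<and> j = n then c else of_bool (i = j)) =
      (\<chi> i j. if i = Some m \<and> j = Some n then c else of_bool (i = j))"
    by (auto simp: vec_eq_iff block_def split: option.split)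
  then show ?case using *[OF idplus] *[of "Some m" "Some n"] idplus by simp
qed

lemma matrix_inv_O1n:
  assumes "g \<in> O1n"
  shows "g ** matrix_inv g = mat 1" "matrix_inv g ** g = mat 1"
  using assms by (auto simp: O1n_def invertible_def matrix_inv_def intro: someI2_ex)

theorem proj_fibre:
  fixes g h :: "real^('n::finite option)^('n option)"
  assumes "g \<in> SO1n" "h \<in> SO1n"
  shows "proj g = proj h \<longleftrightarrow> (\<exists>k\<in>SOn. h = g ** k)"
proof
  assume "\<exists>k\<in>SOn. h = g ** k"
  moreover have "proj k = axis None 1" if "k \<in> SOn" for k :: "real^('n option)^('n option)"
    using that by (auto simp: SOn_def vec_eq_iff proj_nth block_def axis_def split: option.split)
  ultimately show "proj g = proj h"
    by (auto simp: proj_def matrix_vector_mul_assoc[symmetric])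
next
  assume eq: "proj g = proj h"
  have g: "g \<in> O1n" and h: "h \<in> O1n" using assms SO1n_subset by auto
  define k where "k = matrix_inv g ** h"
  have gk: "h = g ** k"
    by (simp add: k_def matrix_mul_assoc matrix_inv_O1n[OF g])
  have "transpose k ** lorentz ** k = transpose k ** (transpose g ** lorentz ** g) ** k"
    using g by (simp add: O1n_iff)
  also have "\<dots> = transpose h ** lorentz ** h"
    by (simp add: gk matrix_transpose_mul matrix_mul_assoc)
  finally have "k \<in> O1n"
    using h by (simp add: O1n_iff)
  then have comp: "- (k $ None $ i * k $ None $ j) + (\<Sum>l\<in>UNIV. k $ Some l $ i * k $ Some l $ j)
     = (if i = j then (if i = None then -1 else 1) else 0)" for i j
    by (simp add: O1n_component_iff)
  have "proj k = matrix_inv g *v proj h"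
    by (simp add: k_def proj_def matrix_vector_mul_assoc)
  also have "\<dots> = matrix_inv g *v proj g"
    by (simp add: eq)
  also have "\<dots> = axis None 1"
    by (simp add: proj_def matrix_vector_mul_assoc matrix_inv_O1n[OF g])
  finally have pk: "proj k = axis None 1" .
  have col: "k $ i $ None = (if i = None then 1 else 0)" for i
    unfolding proj_nth[symmetric] pk by (simp add: axis_def)
  have row: "k $ None $ Some l = 0" for l
    using comp[of None "Some l"] by (simp add: col)
  define B where "B = (\<chi> i j. k $ Some i $ Some j)"
  have kB: "k = block 1 B"
    by (auto simp: vec_eq_iff block_def B_def col row split: option.split)
  have "(transpose B ** B) $ i $ j = mat 1 $ i $ j" for i j
    using comp[of "Some i" "Some j"] by (simp add: transpose_mult_nth B_def mat_def row)
  then have "orthogonal_matrix B"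
    unfolding orthogonal_matrix vec_eq_iff by blast
  moreover have "det k = 1"
    using det_SO1n[OF assms(1)] det_SO1n[OF assms(2)] by (simp add: gk det_mul)
  ultimately have "k \<in> SOn"
    by (auto simp: SOn_def rotation_matrix_def kB det_block)
  then show "\<exists>k\<in>SOn. h = g ** k"
    using gk by blast
qed

lemma so1n_iff:
  fixes A :: "real^('n::finite option)^('n option)"
  shows "A \<in> so1n \<longleftrightarrow> A $ None $ None = 0 \<and> (\<forall>k. A $ Some k $ None = A $ None $ Some k) \<and>
     (\<forall>k l. A $ Some k $ Some l = - (A $ Some l $ Some k))"
proof -
  have "transpose lorentz = (lorentz :: real^('n option)^('n option))"
    by (auto simp: lorentz_def transpose_def vec_eq_iff)
  then have "transpose A ** lorentz = transpose (lorentz ** A)"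
    by (simp add: matrix_transpose_mul)
  then have "(transpose A ** lorentz) $ i $ j = (if j = None then - (A $ None $ i) else A $ j $ i)"
    for i j
    by (simp add: transpose_def lorentz_mult_matrix)
  then have *: "A \<in> so1n \<longleftrightarrow> (\<forall>i j. (if j = None then - (A $ None $ i) else A $ j $ i) +
      (if i = None then - (A $ None $ j) else A $ i $ j) = 0)"
    by (simp add: so1n_def vec_eq_iff lorentz_mult_matrix)
  show ?thesis
  proof
    assume "A \<in> so1n"
    then have "(if j = None then - (A $ None $ i) else A $ j $ i) +
      (if i = None then - (A $ None $ j) else A $ i $ j) = 0" for i j
      unfolding * by blast
    note eq = this
    show "A $ None $ None = 0 \<and> (\<forall>k. A $ Some k $ None = A $ None $ Some k) \<and>
      (\<forall>k l. A $ Some k $ Some l = - (A $ Some l $ Some k))"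
    proof (intro conjI allI)
      show "A $ None $ None = 0" using eq[of None None] by simp
      show "A $ Some k $ None = A $ None $ Some k" for k using eq[of None "Some k"] by simp
      show "A $ Some k $ Some l = - (A $ Some l $ Some k)" for k l
        using eq[of "Some l" "Some k"] by (simp only: option.simps if_False)
    qed
  next
    assume as: "A $ None $ None = 0 \<and> (\<forall>k. A $ Some k $ None = A $ None $ Some k) \<and>
      (\<forall>k l. A $ Some k $ Some l = - (A $ Some l $ Some k))"
    have a0: "A $ None $ None = 0" and a1: "A $ Some k $ None = A $ None $ Some k" for k
      using as by blast+
    have a2: "A $ Some l $ Some k + A $ Some k $ Some l = 0" for k l
      using as[THEN conjunct2, THEN conjunct2, rule_format, of l k] by linarith
    show "A \<in> so1n"
      unfolding * split_option_all by (simp add: a0 a1 a2)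
  qed
qed

lemma so1nD:
  assumes "A \<in> so1n"
  shows "A $ None $ None = 0" "A $ Some k $ None = A $ None $ Some k"
  using assms unfolding so1n_iff by blast+

lemma lie_inner_eq: "lie_inner A B = (\<Sum>i\<in>UNIV. \<Sum>j\<in>UNIV. A $ i $ j * B $ i $ j) / 2"
  unfolding lie_inner_def trace_def transpose_mult_nth by (subst sum.swap) simp

lemma son_orthogonal_iff:
  fixes A :: "real^('n::finite option)^('n option)"
  assumes "A \<in> so1n"
  shows "(\<forall>B\<in>son. lie_inner A B = 0) \<longleftrightarrow> (\<forall>k l. A $ Some k $ Some l = 0)"
proof
  assume *: "\<forall>B\<in>son. lie_inner A B = 0"
  have "transpose (\<chi> k l. A $ Some k $ Some l) = - (\<chi> k l. A $ Some k $ Some l)"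
    using assms unfolding so1n_iff vec_eq_iff transpose_def vec_lambda_beta vector_uminus_component
    by blast
  then have "block 0 (\<chi> k l. A $ Some k $ Some l) \<in> son"
    unfolding son_def by blast
  with * have "lie_inner A (block 0 (\<chi> k l. A $ Some k $ Some l)) = 0"
    by blast
  then have "(\<Sum>k\<in>UNIV. \<Sum>l\<in>UNIV. A $ Some k $ Some l * A $ Some k $ Some l) = 0"
    by (simp add: lie_inner_eq sum_option block_def)
  then show "\<forall>k l. A $ Some k $ Some l = 0"
    by (simp add: sum_nonneg_eq_0_iff sum_nonneg)
next
  assume "\<forall>k l. A $ Some k $ Some l = 0"
  then show "\<forall>B\<in>son. lie_inner A B = 0"
    by (auto simp: son_def lie_inner_eq sum_option block_def)
qed

lemma left_inner_mult:
  assumes "g \<in> O1n"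
  shows "left_inner g (g ** A) (g ** B) = lie_inner A B"
  by (simp add: left_inner_def matrix_mul_assoc matrix_inv_O1n[OF assms])

theorem proj_horizontal_isometry:
  fixes g :: "real^('n::finite option)^('n option)"
  assumes "g \<in> SO1n" "V \<in> horizontal_space g" "W \<in> horizontal_space g"
  shows "minkowski (proj V) (proj W) = left_inner g V W"
proof -
  have g: "g \<in> O1n" using assms SO1n_subset by auto
  obtain A B where A: "V = g ** A" "A \<in> so1n" "\<forall>k l. A $ Some k $ Some l = 0"
    and B: "W = g ** B" "B \<in> so1n" "\<forall>k l. B $ Some k $ Some l = 0"
    using assms by (auto simp: horizontal_space_def son_orthogonal_iff)
  have "minkowski (proj V) (proj W) = minkowski (proj A) (proj B)"
    by (simp add: proj_def A(1) B(1) matrix_vector_mul_assoc[symmetric] minkowski_O1n[OF g])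
  also have "\<dots> = lie_inner A B"
    using A(3) B(3) by (simp add: minkowski_eq proj_nth lie_inner_eq sum_option so1nD[OF A(2)] so1nD[OF B(2)])
  finally show ?thesis
    by (simp add: A(1) B(1) left_inner_mult[OF g])
qed

theorem proj_horizontal_image:
  fixes g :: "real^('n::finite option)^('n option)"
  assumes "g \<in> SO1n"
  shows "proj ` horizontal_space g = {u. minkowski (proj g) u = 0}"
proof (intro equalityI subsetI)
  have g: "g \<in> O1n" using assms SO1n_subset by auto
  have e: "minkowski (proj g) (g *v w) = - (w $ None)" for w
    unfolding proj_def minkowski_O1n[OF g] by (simp add: minkowski_eq axis_def)
  {
    fix u assume "u \<in> proj ` horizontal_space g"
    then obtain A where "u = g *v proj A" "A \<in> so1n"
      by (auto simp: horizontal_space_def proj_def matrix_vector_mul_assoc[symmetric])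
    then show "u \<in> {u. minkowski (proj g) u = 0}"
      by (simp add: e proj_nth so1nD)
  next
    fix u assume "u \<in> {u. minkowski (proj g) u = 0}"
    define w where "w = matrix_inv g *v u"
    have u: "u = g *v w"
      by (simp add: w_def matrix_vector_mul_assoc matrix_inv_O1n[OF g])
    with \<open>u \<in> _\<close> have w: "w $ None = 0" using e by simp
    define A :: "real^('n option)^('n option)" where "A = (\<chi> i j. case (i, j) of
      (None, Some l) \<Rightarrow> w $ Some l | (Some k, None) \<Rightarrow> w $ Some k | _ \<Rightarrow> 0)"
    have "A \<in> so1n"
      by (simp add: so1n_iff A_def)
    then have "g ** A \<in> horizontal_space g"
      by (auto simp: horizontal_space_def son_orthogonal_iff A_def)
    moreover have "proj A = w"
      by (auto simp: vec_eq_iff proj_nth A_def w split: option.split)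
    then have "proj (g ** A) = u"
      by (simp add: u proj_def matrix_vector_mul_assoc[symmetric])
    ultimately show "u \<in> proj ` horizontal_space g" by blast
  }
qed

end

theory Submission
  imports Defs
begin

text \<open>
  Sweep the disk by the circles that touch its boundary at the base point, contract the boundary
  loop to a point through them, and let \<open>h(s)\<close> be the holonomy of the \<open>s\<close>-th loop. Since \<open>\<pi>\<close> has
  curvature \<open>u \<and> v\<close>, whose norm is the area of the parallelogram spanned by \<open>u\<close> and \<open>v\<close>, the curve
  \<open>h\<close> in \<open>SO(n)\<close> ends at the holonomy of the boundary and is at most as long as the area of the disk.
  Multiplying \<open>h\<close> by a rotation that goes back and forth, with an amplitude found by the
  intermediate value theorem, makes the length equal to the area.

  The horizontal lift of \<open>x\<close> solves the linear equation \<open>g' = (x \<and> x') g\<close> in the matrices, so that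
  existence, uniqueness and dependence on parameters come from the Peano-Baker series.
\<close>

section \<open>The Minkowski form and the Lorentz group\<close>

text \<open>The lift equation is linear for the following reason. A horizontal vector at
  \<open>g\<close> is \<open>g ** A\<close>, where \<open>A\<close> is the bivector of
  \<open>axis None 1\<close> with a space vector; conjugating by \<open>g\<close> turns
  \<open>A\<close> into the bivector of the projected point and its velocity. The coefficient thus
  depends on the projected curve alone. All loops of the sweep begin and end at the base point.
  Hence every holonomy lies in SO(n) without a connecting path, and the boundary terms in its
  variation vanish. The tangent circles are disjoint away from the base point, so no area is counted
  twice. Only an inequality comes out at first: after transport to the base point the curvatures
  along a loop are bivectors in various directions, and their integral may be shorter than the
  integral of their norms. This gap is what the back-and-forth rotation fills. A second obstacle is
  that the given boundary curve is only C^1 and may stand still. Its angle on the circle is first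
  just a continuous function, and its differentiability has to be recovered from the immersion.
  Factors \<open>sqrt 2\<close> arise because \<open>lie_inner A A\<close> is half of the squared
  Euclidean norm.\<close>

lemma bounded_bilinear_matrix_mult:
  "bounded_bilinear (\<lambda>(A::real^'b^'a) (B::real^'c^'b). A ** B)"
  unfolding bilinear_conv_bounded_bilinear[symmetric] bilinear_def linear_iff
  by (simp add: vec_eq_iff matrix_matrix_mult_def distrib_left distrib_right sum.distrib
      sum_distrib_left mult_ac)

lemma bounded_bilinear_matrix_vector:
  "bounded_bilinear (\<lambda>(A::real^'b^'a) x. A *v x)"
  unfolding bilinear_conv_bounded_bilinear[symmetric] bilinear_def linear_iff
  by (simp add: matrix_vector_right_distrib matrix_vector_mult_add_rdistrib
      matrix_vector_mult_scaleR scaleR_matrix_vector_assoc)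

interpretation matrix_mult: bounded_bilinear "\<lambda>(A::real^'b^'a) (B::real^'c^'b). A ** B"
  by (rule bounded_bilinear_matrix_mult)

interpretation matrix_vector: bounded_bilinear "\<lambda>(A::real^'b^'a) x. A *v x"
  by (rule bounded_bilinear_matrix_vector)

lemmas continuous_on_matrix_mult [continuous_intros] = matrix_mult.continuous_on
lemmas continuous_on_matrix_vector [continuous_intros] = matrix_vector.continuous_on

lemma bounded_bilinear_minkowski: "bounded_bilinear (minkowski :: real^('n::finite option) \<Rightarrow> _)"
  unfolding bilinear_conv_bounded_bilinear[symmetric] bilinear_def linear_iff
  by (simp add: minkowski_eq distrib_left distrib_right sum.distrib sum_distrib_left
      right_diff_distrib mult_ac)

interpretation minkowski: bounded_bilinear "minkowski :: real^('n::finite option) \<Rightarrow> _"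
  by (rule bounded_bilinear_minkowski)

lemmas continuous_on_minkowski [continuous_intros] = minkowski.continuous_on

lemma minkowski_commute: "minkowski x y = minkowski y x"
  by (simp add: minkowski_eq mult.commute)

text \<open>The adjoint with respect to the Minkowski form. On \<open>O1n\<close> it agrees with
  \<open>matrix_inv\<close>, and it is linear, so it can stand for the inverse wherever derivatives
  are taken.\<close>

definition minkowski_adjoint ::
  "real^('n::finite option)^('n option) \<Rightarrow> real^('n option)^('n option)" where
  "minkowski_adjoint A = lorentz ** transpose A ** lorentz"

lemma transpose_lorentz: "transpose lorentz = lorentz"
  by (auto simp: lorentz_def transpose_def vec_eq_iff)

lemma minkowski_adjoint_right: "minkowski (A *v x) y = minkowski x (minkowski_adjoint A *v y)"
proof -
  have "minkowski (A *v x) y = x \<bullet> ((transpose A ** lorentz) *v y)"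
    unfolding minkowski_def
    by (metis dot_lmul_matrix vector_transpose_matrix matrix_vector_mul_assoc)
  also have "\<dots> = minkowski x (minkowski_adjoint A *v y)"
    by (simp add: minkowski_def minkowski_adjoint_def matrix_vector_mul_assoc matrix_mul_assoc
        lorentz_lorentz)
  finally show ?thesis .
qed

lemma minkowski_adjoint_mult:
  "minkowski_adjoint (A ** B) = minkowski_adjoint B ** minkowski_adjoint A"
proof -
  have "lorentz ** X ** lorentz ** (lorentz ** Y) = lorentz ** X ** Y" for X Y :: "real^('n::finite option)^('n option)"
    by (metis lorentz_lorentz matrix_mul_assoc matrix_mul_rid)
  from this[of "transpose B" "transpose A ** lorentz"] show ?thesis
    by (simp add: minkowski_adjoint_def matrix_transpose_mul matrix_mul_assoc)
qed

lemma minkowski_adjoint_mat_1: "minkowski_adjoint (mat 1) = mat 1"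
  by (simp add: minkowski_adjoint_def transpose_mat lorentz_lorentz)

lemma minkowski_adjoint_nth:
  "minkowski_adjoint A $ i $ j =
    (if i = None then -1 else 1) * (if j = None then -1 else 1) * A $ j $ i"
proof -
  have "minkowski_adjoint A $ i $ j = (if i = None then -1 else 1) * (transpose A ** lorentz) $ i $ j"
    by (simp add: minkowski_adjoint_def lorentz_mult_matrix flip: matrix_mul_assoc)
  also have "(transpose A ** lorentz) $ i $ j = transpose (lorentz ** A) $ i $ j"
    by (simp add: matrix_transpose_mul transpose_lorentz)
  also have "\<dots> = (if j = None then -1 else 1) * A $ j $ i"
    by (simp add: transpose_def lorentz_mult_matrix)
  finally show ?thesis by simp
qed

lemma bounded_linear_minkowski_adjoint:
  "bounded_linear (minkowski_adjoint :: real^('n::finite option)^('n option) \<Rightarrow> _)"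
  unfolding linear_conv_bounded_linear[symmetric] linear_iff
  by (auto simp: vec_eq_iff minkowski_adjoint_nth)

lemmas continuous_on_minkowski_adjoint [continuous_intros] =
  bounded_linear.continuous_on[OF bounded_linear_minkowski_adjoint]

lemma O1n_iff_adjoint: "A \<in> O1n \<longleftrightarrow> minkowski_adjoint A ** A = mat 1"
proof -
  have "minkowski_adjoint A ** A = lorentz ** (transpose A ** lorentz ** A)"
    by (simp add: minkowski_adjoint_def matrix_mul_assoc)
  then show ?thesis
    unfolding O1n_iff by (metis lorentz_lorentz matrix_mul_assoc matrix_mul_lid)
qed

lemma O1n_adjoint:
  assumes "A \<in> O1n"
  shows "minkowski_adjoint A ** A = mat 1" "A ** minkowski_adjoint A = mat 1"
  using assms by (auto simp: O1n_iff_adjoint matrix_left_right_inverse)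

lemma O1n_mult:
  assumes "A \<in> O1n" "B \<in> O1n"
  shows "A ** B \<in> O1n"
proof -
  have "minkowski_adjoint B ** (minkowski_adjoint A ** A) ** B = mat 1"
    using assms by (simp add: O1n_iff_adjoint)
  then show ?thesis
    by (simp add: O1n_iff_adjoint minkowski_adjoint_mult matrix_mul_assoc)
qed

lemma matrix_inv_eq_adjoint: "A \<in> O1n \<Longrightarrow> matrix_inv A = minkowski_adjoint A"
  by (metis O1n_adjoint(2) matrix_inv_O1n(2) matrix_mul_assoc matrix_mul_lid matrix_mul_rid)

text \<open>The matrix of \<open>x \<and> v\<close> under the identification of bivectors with the Lorentz Lie algebra.\<close>

definition minkowski_wedge ::
  "real^('n::finite option) \<Rightarrow> real^('n option) \<Rightarrow> real^('n option)^('n option)" where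
  "minkowski_wedge x v = (\<chi> i j. x $ i * (lorentz *v v) $ j - v $ i * (lorentz *v x) $ j)"

lemma minkowski_wedge_mult:
  "minkowski_wedge x v *v y = minkowski v y *\<^sub>R x - minkowski x y *\<^sub>R v"
proof -
  have *: "(lorentz *v v) \<bullet> y = minkowski v y" for v
    by (metis inner_commute minkowski_commute minkowski_def)
  have row: "minkowski_wedge x v $ i = x $ i *\<^sub>R (lorentz *v v) - v $ i *\<^sub>R (lorentz *v x)" for i
    by (simp add: minkowski_wedge_def vec_eq_iff)
  show ?thesis
    by (simp add: vec_eq_iff matrix_vector_mul_component row inner_diff_left * mult.commute)
qed

lemma bounded_bilinear_minkowski_wedge:
  "bounded_bilinear (minkowski_wedge :: real^('n::finite option) \<Rightarrow> _)"
  unfolding bilinear_conv_bounded_bilinear[symmetric] bilinear_def linear_iff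
  by (auto simp: vec_eq_iff minkowski_wedge_def lorentz_mult algebra_simps)

interpretation minkowski_wedge: bounded_bilinear
  "minkowski_wedge :: real^('n::finite option) \<Rightarrow> _"
  by (rule bounded_bilinear_minkowski_wedge)

lemmas continuous_on_minkowski_wedge [continuous_intros] = minkowski_wedge.continuous_on

lemma minkowski_adjoint_wedge:
  "minkowski_adjoint (minkowski_wedge x v) = - minkowski_wedge x v"
  by (auto simp: vec_eq_iff minkowski_adjoint_nth minkowski_wedge_def lorentz_mult)

lemma minkowski_wedge_commute: "minkowski_wedge x v = - minkowski_wedge v x"
  by (auto simp: vec_eq_iff minkowski_wedge_def)

text \<open>Naturality of the bivector under Lorentz transformations:
  \<open>minkowski_adjoint A\<close> is the inverse of \<open>A\<close>. It serves to carry
  bivectors at a point of the hyperboloid to the base point.\<close>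

lemma adjoint_wedge_conj:
  assumes "A \<in> O1n"
  shows "minkowski_adjoint A ** minkowski_wedge u v ** A =
    minkowski_wedge (minkowski_adjoint A *v u) (minkowski_adjoint A *v v)"
proof -
  have "minkowski z (A *v y) = minkowski (minkowski_adjoint A *v z) y" for z y
    by (metis minkowski_adjoint_right minkowski_commute)
  then show ?thesis
    by (simp add: matrix_eq minkowski_wedge_mult matrix_vector_mult_diff_distrib
        matrix_vector_mult_scaleR flip: matrix_vector_mul_assoc)
qed

section \<open>Areas as norms of bivectors\<close>

lemma lie_inner_self: "lie_inner A A = (norm A)\<^sup>2 / 2"
  by (simp add: lie_inner_eq power2_norm_eq_inner inner_vec_def)

text \<open>Lagrange's identity. The signs of the Minkowski form enter squared and disappear, which
  leaves the Euclidean Gram determinant; each pair of indices occurs twice, and the factor 1/2 in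
  \<open>lie_inner\<close> compensates for this.\<close>

lemma lie_inner_wedge:
  fixes a b :: "real^('n::finite option)"
  shows "lie_inner (minkowski_wedge a b) (minkowski_wedge a b) = (a \<bullet> a) * (b \<bullet> b) - (a \<bullet> b)\<^sup>2"
proof -
  define e :: "'n option \<Rightarrow> real" where "e j = (if j = None then -1 else 1)" for j
  have e: "e j * e j = 1" "(lorentz *v x) $ j = e j * x $ j" for j x
    by (auto simp: e_def lorentz_mult)
  have "minkowski_wedge a b $ i $ j * minkowski_wedge a b $ i $ j =
     (e j * e j) * (a $ i * a $ i * (b $ j * b $ j) + b $ i * b $ i * (a $ j * a $ j)
        - 2 * (a $ i * b $ i * (a $ j * b $ j)))" for i j
    by (simp add: minkowski_wedge_def e(2) algebra_simps)
  then have *: "minkowski_wedge a b $ i $ j * minkowski_wedge a b $ i $ j =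
     (a $ i * a $ i * (b $ j * b $ j) + b $ i * b $ i * (a $ j * a $ j)
        - 2 * (a $ i * b $ i * (a $ j * b $ j)))" for i j
    by (simp add: e)
  show ?thesis
    unfolding lie_inner_eq *
    by (simp add: sum.distrib sum_subtractf inner_vec_def power2_eq_square mult.commute
       flip: sum_distrib_left sum_distrib_right)
qed

definition gram :: "real^('n::finite option) \<Rightarrow> real^('n option) \<Rightarrow> real" where
  "gram u v = minkowski u u * minkowski v v - (minkowski u v)\<^sup>2"

text \<open>Pulled back by \<open>g\<close>, vectors tangent at \<open>x\<close> lose their time
  component, so the Minkowski form becomes the Euclidean inner product and Lagrange's identity
  applies. The conjugation matters: the Euclidean norm of a matrix is not invariant under it, and
  only the bivector brought to the base point has the area as its norm.\<close>

lemma gram_tangent: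
  fixes g :: "real^('n::finite option)^('n option)"
  assumes g: "g \<in> O1n" and x: "g *v axis None 1 = x"
    and u: "minkowski x u = 0" and v: "minkowski x v = 0"
  shows "gram u v = lie_inner (minkowski_adjoint g ** minkowski_wedge u v ** g)
                              (minkowski_adjoint g ** minkowski_wedge u v ** g)"
proof -
  define a where "a = minkowski_adjoint g *v u"
  define b where "b = minkowski_adjoint g *v v"
  have ab: "u = g *v a" "v = g *v b"
    by (simp_all add: a_def b_def matrix_vector_mul_assoc O1n_adjoint[OF g])
  have "minkowski (axis None 1) w = - (w $ None)" for w :: "real^('n option)"
    by (simp add: minkowski_eq axis_def)
  with u v have "a $ None = 0" "b $ None = 0"
    by (simp_all add: ab minkowski_O1n[OF g] flip: x)
  then have "minkowski a a = a \<bullet> a" "minkowski a b = a \<bullet> b" "minkowski b b = b \<bullet> b"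
    by (simp_all add: minkowski_eq inner_vec_def sum_option)
  then show ?thesis
    unfolding adjoint_wedge_conj[OF g] a_def[symmetric] b_def[symmetric] lie_inner_wedge
    by (simp add: gram_def ab minkowski_O1n[OF g])
qed

lemma gram_linear:
  "gram (a *\<^sub>R u + b *\<^sub>R v) (c *\<^sub>R u + d *\<^sub>R v) = (a * d - b * c)\<^sup>2 * gram u v"
  by (simp add: gram_def minkowski.add_left minkowski.add_right minkowski.scaleR_left
      minkowski.scaleR_right minkowski_commute[of v u] power2_eq_square algebra_simps)

text \<open>At the identity the complement of \<open>son\<close> consists of the bivectors of
  \<open>axis None 1\<close> with space vectors; conjugation by \<open>g\<close> moves them to
  \<open>proj g\<close>. Horizontality thereby becomes a linear differential equation for the
  lift.\<close>

lemma horizontal_space_wedge: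
  fixes g :: "real^('n::finite option)^('n option)"
  assumes g: "g \<in> O1n" and V: "V \<in> horizontal_space g"
  shows "V = minkowski_wedge (proj g) (proj V) ** g"
proof -
  obtain A where A: "V = g ** A" "A \<in> so1n" "\<forall>k l. A $ Some k $ Some l = 0"
    using V by (auto simp: horizontal_space_def son_orthogonal_iff)
  have "A = minkowski_wedge (axis None 1) (proj A)"
    using A(2,3) unfolding vec_eq_iff split_option_all
    by (simp add: minkowski_wedge_def lorentz_mult proj_nth axis_def so1nD)
  also have "\<dots> = minkowski_wedge (minkowski_adjoint g *v proj g) (minkowski_adjoint g *v proj V)"
    by (simp add: A(1) proj_def matrix_vector_mul_assoc matrix_mul_assoc O1n_adjoint[OF g])
  also have "\<dots> = minkowski_adjoint g ** minkowski_wedge (proj g) (proj V) ** g"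
    by (simp add: adjoint_wedge_conj[OF g])
  finally have "g ** A = g ** (minkowski_adjoint g ** minkowski_wedge (proj g) (proj V) ** g)"
    by simp
  then show ?thesis
    by (simp add: A(1) matrix_mul_assoc O1n_adjoint[OF g])
qed

lemma SO1n_path:
  assumes "continuous_on {0..1::real} c" "c 0 = mat 1" "\<And>t. t \<in> {0..1} \<Longrightarrow> c t \<in> O1n" "t \<in> {0..1}"
  shows "c t \<in> SO1n"
  using assms
  by (intro SO1n_I[of "c ` {0..1}"] connected_continuous_image) (force simp: image_iff)+

text \<open>The fibre through the identity. Curves built from matrices are shown to lie in
  \<open>SOn\<close> by this criterion: a path from the identity inside \<open>O1n\<close> that
  fixes the base vector.\<close>

lemma SO1n_stabilizer:
  assumes "k \<in> SO1n" "proj k = axis None 1"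
  shows "k \<in> SOn"
proof -
  have "mat 1 \<in> SO1n"
    by (simp add: SO1n_def mat1_O1n)
  moreover have "proj (mat 1) = axis None 1"
    by (simp add: proj_def)
  ultimately show ?thesis
    using proj_fibre[of "mat 1" k] assms by auto
qed

section \<open>Linear differential equations with parameters\<close>

lemma continuous_on_section:
  assumes "continuous_on (S \<times> T) (\<lambda>(s, t). u s t)" "s \<in> S"
  shows "continuous_on T (u s)"
  using continuous_on_compose2[OF assms(1), of T "\<lambda>t. (s, t)"] assms(2)
  by (force intro: continuous_on_Pair)

text \<open>The substitution \<open>t * r\<close> moves the variable endpoint into the integrand, so
  that an integral over a fixed interval with a jointly continuous integrand remains.\<close>

lemma continuous_on_indefinite_integral_param:
  fixes u :: "'s::topological_space \<Rightarrow> real \<Rightarrow> 'a::euclidean_space"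
  assumes cont: "continuous_on (S \<times> {0..1}) (\<lambda>(s, t). u s t)"
  shows "continuous_on (S \<times> {0..1}) (\<lambda>(s, t). integral {0..t} (u s))"
proof -
  have eq: "integral {0..t} (u s) = integral (cbox 0 1) (\<lambda>r. t *\<^sub>R u s (t * r))"
    if "s \<in> S" "t \<in> {0..1}" for s t
  proof -
    have "((\<lambda>r. t *\<^sub>R u s (t * r)) has_integral (integral {t * 0..t * 1} (u s))) {0..1}"
      using that continuous_on_section[OF cont]
      by (intro has_integral_substitution[where c = 0 and d = 1])
        (auto intro!: derivative_eq_intros mult_le_one)
    then show ?thesis
      by (simp add: has_integral_iff)
  qed
  have "continuous_on (S \<times> {0..1}) (\<lambda>p. integral (cbox 0 1) (\<lambda>r. snd p *\<^sub>R u (fst p) (snd p * r)))"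
  proof (rule integral_continuous_on_param)
    have "continuous_on ((S \<times> {0..1}) \<times> cbox 0 1) (\<lambda>q. u (fst (fst q)) (snd (fst q) * snd q))"
      by (rule continuous_on_compose2[OF cont[unfolded split_beta], of _ "\<lambda>q. (fst (fst q), snd (fst q) * snd q)", unfolded fst_conv snd_conv])
        (auto intro!: continuous_intros mult_le_one)
    then show "continuous_on ((S \<times> {0..1}) \<times> cbox 0 1)
        (\<lambda>(p, r). snd p *\<^sub>R u (fst p) (snd p * r))"
      unfolding split_beta by (intro continuous_intros)
  qed
  then show ?thesis
    by (rule continuous_on_eq) (auto simp: eq)
qed

text \<open>The k-th iterated integral is at most a constant times C^k t^k / k!, a bound that is
  uniform in the parameter. The series therefore converges uniformly on
  \<open>S \<times> {0..1}\<close>, and its sum is continuous in both variables jointly.\<close>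

lemma linear_ode_exists:
  fixes P :: "'s::metric_space \<Rightarrow> real \<Rightarrow> real^'m^'m"
  assumes S: "compact S" and P: "continuous_on (S \<times> {0..1}) (\<lambda>(s, t). P s t)"
  obtains g where "continuous_on (S \<times> {0..1}) (\<lambda>(s, t). g s t)" "\<And>s. g s 0 = mat 1"
    "\<And>s t. s \<in> S \<Longrightarrow> t \<in> {0..1} \<Longrightarrow>
      (g s has_vector_derivative P s t ** g s t) (at t within {0..1})"
proof -
  define y where "y = rec_nat (\<lambda>s t. mat 1 :: real^'m^'m)
    (\<lambda>k u s t. integral {0..t} (\<lambda>\<tau>. P s \<tau> ** u s \<tau>))"
  have y0: "y 0 s t = mat 1" and ySuc: "y (Suc k) s t = integral {0..t} (\<lambda>\<tau>. P s \<tau> ** y k s \<tau>)"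
    for k s t by (simp_all add: y_def)
  have cont: "continuous_on (S \<times> {0..1}) (\<lambda>(s, t). y k s t)" for k
  proof (induction k)
    case 0
    then show ?case by (simp add: y0 split_beta)
  next
    case (Suc k)
    have "continuous_on (S \<times> {0..1}) (\<lambda>(s, t). P s t ** y k s t)"
      using P Suc unfolding split_beta by (intro continuous_intros)
    from continuous_on_indefinite_integral_param[OF this] show ?case
      by (simp add: ySuc)
  qed
  obtain C where C: "C > 0" "\<And>s t X. s \<in> S \<Longrightarrow> t \<in> {0..1} \<Longrightarrow> norm (P s t ** (X::real^'m^'m)) \<le> C * norm X"
  proof -
    have "bounded ((\<lambda>(s, t). P s t) ` (S \<times> {0..1}))"
      by (intro compact_imp_bounded compact_continuous_image P compact_Times S) auto
    then obtain B where B: "B > 0" "\<And>s t. s \<in> S \<Longrightarrow> t \<in> {0..1} \<Longrightarrow> norm (P s t) \<le> B"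
      unfolding bounded_pos by fastforce
    obtain K where K: "K > 0" "\<And>(A :: real^'m^'m) (X :: real^'m^'m). norm (A ** X) \<le> norm A * norm X * K"
      using matrix_mult.pos_bounded by blast
    have "norm (P s t ** X) \<le> B * K * norm X" if "s \<in> S" "t \<in> {0..1}" for s t and X :: "real^'m^'m"
    proof -
      have "norm (P s t ** X) \<le> norm (P s t) * norm X * K" by (rule K)
      also have "\<dots> \<le> B * norm X * K"
        using B(2)[OF that] K(1) by (intro mult_right_mono) auto
      finally show ?thesis by (simp add: mult_ac)
    qed
    then show ?thesis using that[of "B * K"] B K by auto
  qed
  \<comment> \<open>In the Euclidean norm the identity matrix does not have norm 1 in general, so
    its norm is carried along as a constant.\<close>
  define N where "N = norm (mat 1 :: real^'m^'m)"
  have N: "N \<ge> 0" by (simp add: N_def)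
  have bound: "norm (y k s t) \<le> N * C ^ k * t ^ k / fact k" if "s \<in> S" "t \<in> {0..1}" for k s t
    using that(2)
  proof (induction k arbitrary: t)
    case 0
    then show ?case by (simp add: y0 N_def)
  next
    case (Suc k)
    have I: "((\<lambda>\<tau>. C * (N * C ^ k * \<tau> ^ k / fact k)) has_integral
       (N * C ^ Suc k * t ^ Suc k / fact (Suc k) - N * C ^ Suc k * 0 ^ Suc k / fact (Suc k))) {0..t}"
    proof (rule fundamental_theorem_of_calculus)
      fix x assume "x \<in> {0..t}"
      have "((\<lambda>\<tau>. N * C ^ Suc k * \<tau> ^ Suc k / fact (Suc k)) has_real_derivative
        N * C ^ Suc k * (real (Suc k) * x ^ k) / fact (Suc k)) (at x within {0..t})"
        by (intro derivative_eq_intros | simp)+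
      also have "N * C ^ Suc k * (real (Suc k) * x ^ k) / fact (Suc k) = C * (N * C ^ k * x ^ k / fact k)"
        by (simp add: field_simps del: of_nat_Suc)
      finally show "((\<lambda>\<tau>. N * C ^ Suc k * \<tau> ^ Suc k / fact (Suc k)) has_vector_derivative
        C * (N * C ^ k * x ^ k / fact k)) (at x within {0..t})"
        by (simp only: has_real_derivative_iff_has_vector_derivative)
    qed (use Suc.prems in auto)
    have "continuous_on {0..t} (\<lambda>\<tau>. P s \<tau> ** y k s \<tau>)"
      using Suc.prems
      by (intro continuous_intros continuous_on_subset[OF continuous_on_section[OF P \<open>s \<in> S\<close>]]
        continuous_on_subset[OF continuous_on_section[OF cont \<open>s \<in> S\<close>]]) auto
    then have "norm (y (Suc k) s t) \<le> integral {0..t} (\<lambda>\<tau>. C * (N * C ^ k * \<tau> ^ k / fact k))"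
      unfolding ySuc
    proof (intro integral_norm_bound_integral integrable_continuous_real)
      fix \<tau> assume \<tau>: "\<tau> \<in> {0..t}"
      have "norm (P s \<tau> ** y k s \<tau>) \<le> C * norm (y k s \<tau>)"
        using \<tau> Suc.prems by (intro C \<open>s \<in> S\<close>) auto
      also have "\<dots> \<le> C * (N * C ^ k * \<tau> ^ k / fact k)"
        using \<tau> Suc.prems C(1) by (intro mult_left_mono Suc.IH) auto
      finally show "norm (P s \<tau> ** y k s \<tau>) \<le> C * (N * C ^ k * \<tau> ^ k / fact k)" .
    qed (auto intro!: continuous_intros)
    also have "\<dots> = N * C ^ Suc k * t ^ Suc k / fact (Suc k)"
      using I by (simp add: has_integral_iff)
    finally show ?case .
  qed
  define g where "g s t = (\<Sum>k. y k s t)" for s t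
  have ul: "uniform_limit (S \<times> {0..1}) (\<lambda>n p. \<Sum>k<n. y k (fst p) (snd p)) (\<lambda>p. g (fst p) (snd p)) sequentially"
    unfolding g_def
  proof (rule Weierstrass_m_test[where M = "\<lambda>k. N * (C ^ k / fact k)"])
    fix k and p :: "'s \<times> real" assume p: "p \<in> S \<times> {0..1}"
    then have "norm (y k (fst p) (snd p)) \<le> N * (C ^ k / fact k) * snd p ^ k"
      using bound[of "fst p" "snd p" k] by auto
    also have "\<dots> \<le> N * (C ^ k / fact k) * 1"
      using p N C(1) by (intro mult_left_mono power_le_one) auto
    finally show "norm (y k (fst p) (snd p)) \<le> N * (C ^ k / fact k)" by simp
  next
    show "summable (\<lambda>k. N * (C ^ k / fact k))"
      using summable_exp_generic[of C] by (intro summable_mult) (simp add: divide_inverse mult.commute)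
  qed
  have gc: "continuous_on (S \<times> {0..1}) (\<lambda>(s, t). g s t)"
    unfolding split_beta
    by (rule uniform_limit_theorem[OF always_eventually ul])
      (use cont in \<open>auto simp: split_beta intro!: continuous_on_sum\<close>)
  have g0: "g s 0 = mat 1" for s
  proof -
    have "y k s 0 = (if k = 0 then mat 1 else 0)" for k
      by (cases k) (auto simp: y0 ySuc)
    then show ?thesis
      using sums_If_finite_set[of "{0::nat}" "\<lambda>_. mat 1 :: real^'m^'m"] by (simp add: g_def sums_iff)
  qed
  \<comment> \<open>Integrating the partial sums shifts the index by one; in the uniform limit this
    is the integral form of the equation, and its right-hand side is visibly differentiable.\<close>
  have int_eq: "g s t = mat 1 + integral {0..t} (\<lambda>\<tau>. P s \<tau> ** g s \<tau>)"
    if st: "s \<in> S" "t \<in> {0..1}" for s t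
  proof -
    have sub: "{0..t} \<subseteq> {0..1}" using st by auto
    have Ps: "continuous_on {0..t} (P s)" and gs: "continuous_on {0..t} (g s)"
      and ys: "continuous_on {0..t} (y k s)" for k
      using continuous_on_section[OF P st(1)] continuous_on_section[OF gc st(1)]
        continuous_on_section[OF cont st(1)] sub by (blast intro: continuous_on_subset)+
    have uls: "uniform_limit {0..t} (\<lambda>n \<tau>. \<Sum>k<n. y k s \<tau>) (g s) sequentially"
      using uniform_limit_compose'[OF ul, of "\<lambda>\<tau>. (s, \<tau>)" "{0..t}"] st sub by auto
    have ulP: "uniform_limit {0..t} (\<lambda>n \<tau>. P s \<tau> ** (\<Sum>k<n. y k s \<tau>)) (\<lambda>\<tau>. P s \<tau> ** g s \<tau>) sequentially"
      by (intro matrix_mult.bounded_uniform_limit uls uniform_limit_const compact_imp_bounded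
          compact_continuous_image Ps gs) auto
    obtain I J where I: "\<And>n. ((\<lambda>\<tau>. P s \<tau> ** (\<Sum>k<n. y k s \<tau>)) has_integral I n) {0..t}"
      and J: "((\<lambda>\<tau>. P s \<tau> ** g s \<tau>) has_integral J) {0..t}" and IJ: "I \<longlonglongrightarrow> J"
      by (rule uniform_limit_integral[OF ulP]) (auto intro!: continuous_intros Ps ys)
    have "I n = (\<Sum>k<n. y (Suc k) s t)" for n
    proof -
      have "I n = integral {0..t} (\<lambda>\<tau>. \<Sum>k<n. P s \<tau> ** y k s \<tau>)"
        using I[of n] by (simp add: has_integral_iff matrix_mult.sum_right)
      also have "\<dots> = (\<Sum>k<n. y (Suc k) s t)"
        unfolding ySuc
        by (intro integral_sum integrable_continuous_real continuous_intros Ps ys) auto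
      finally show ?thesis .
    qed
    then have "(\<Sum>k<Suc n. y k s t) = mat 1 + I n" for n
      by (simp add: sum.lessThan_Suc_shift y0 del: sum.lessThan_Suc)
    moreover have "(\<lambda>n. \<Sum>k<Suc n. y k s t) \<longlonglongrightarrow> g s t"
      by (rule LIMSEQ_Suc) (use tendsto_uniform_limitI[OF ul, of "(s, t)"] st in simp)
    ultimately have "(\<lambda>n. mat 1 + I n) \<longlonglongrightarrow> g s t"
      by simp
    then show ?thesis
      using IJ J LIMSEQ_unique[OF _ tendsto_add[OF tendsto_const IJ]] by (metis integral_unique)
  qed
  have "(g s has_vector_derivative P s t ** g s t) (at t within {0..1})"
    if st: "s \<in> S" "t \<in> {0..1}" for s t
  proof -
    have "continuous_on {0..1} (\<lambda>\<tau>. P s \<tau> ** g s \<tau>)"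
      by (intro continuous_intros continuous_on_section[OF P st(1)] continuous_on_section[OF gc st(1)])
    then have "((\<lambda>t. mat 1 + integral {0..t} (\<lambda>\<tau>. P s \<tau> ** g s \<tau>)) has_vector_derivative P s t ** g s t)
        (at t within {0..1})"
      by (auto intro!: derivative_eq_intros integral_has_vector_derivative st(2))
    then show ?thesis
      by (rule has_vector_derivative_transform[OF st(2), rotated]) (simp add: int_eq st(1))
  qed
  with gc g0 show ?thesis using that by blast
qed

section \<open>Holonomy of a family of loops\<close>

text \<open>Caratheodory's form of the derivative: \<open>\<Psi>\<close> is the slope, and its value
  at \<open>x\<close> is the derivative. The holonomy is differentiated in the loop parameter with
  it, since there an exact formula for the difference is at hand.\<close>

lemma has_vector_derivative_caratheodory:
  assumes eq: "\<And>y. y \<in> S \<Longrightarrow> f y - f x = (y - x) *\<^sub>R \<Psi> y"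
    and cont: "continuous_on S \<Psi>" and x: "x \<in> S"
  shows "(f has_vector_derivative \<Psi> x) (at x within S)"
  unfolding has_vector_derivative_def has_derivative_iff_norm
proof (intro conjI bounded_linear_scaleR_left)
  have "((\<lambda>y. norm (\<Psi> y - \<Psi> x)) \<longlongrightarrow> 0) (at x within S)"
    using cont x by (auto simp: continuous_on_def intro!: tendsto_eq_intros)
  moreover have "\<forall>\<^sub>F y in at x within S.
      norm (\<Psi> y - \<Psi> x) = norm (f y - f x - (y - x) *\<^sub>R \<Psi> x) / norm (y - x)"
    unfolding eventually_at_filter
    by (rule always_eventually) (simp add: eq flip: scaleR_diff_right)
  ultimately show "((\<lambda>y. norm (f y - f x - (y - x) *\<^sub>R \<Psi> x) / norm (y - x)) \<longlongrightarrow> 0) (at x within S)"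
    by (rule Lim_transform_eventually)
qed

lemma has_vector_derivative_unique_unit_interval:
  assumes "(f has_vector_derivative a) (at t within {0..1})"
    "(f has_vector_derivative b) (at t within {0..1})" "t \<in> {0..1::real}"
  shows "a = b"
  using vector_derivative_unique_within_closed_interval[of 0 1 t f a b] assms by simp

text \<open>Variation of constants. As \<open>P t\<close> is skew for the Minkowski form, the
  adjoint of \<open>Y\<close> satisfies the equation with \<open>- P t\<close> multiplied on the
  right, and the two contributions combine to \<open>Q t - P t\<close>. With \<open>Q = P\<close>
  the product is constant, which yields both invariance of \<open>O1n\<close> and uniqueness; with
  two loops of a family it compares their holonomies.\<close>

lemma minkowski_adjoint_ode:
  fixes Y Z :: "real \<Rightarrow> real^('n::finite option)^('n option)"
  assumes Y: "\<And>t. t \<in> {0..1} \<Longrightarrow> (Y has_vector_derivative P t ** Y t) (at t within {0..1})"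
    and Z: "\<And>t. t \<in> {0..1} \<Longrightarrow> (Z has_vector_derivative Q t ** Z t) (at t within {0..1})"
    and P: "\<And>t. t \<in> {0..1} \<Longrightarrow> minkowski_adjoint (P t) = - P t"
    and t: "t \<in> {0..1}"
  shows "((\<lambda>t. minkowski_adjoint (Y t) ** Z t) has_vector_derivative
    minkowski_adjoint (Y t) ** (Q t - P t) ** Z t) (at t within {0..1})"
proof -
  have "((\<lambda>t. minkowski_adjoint (Y t) ** Z t) has_vector_derivative
      minkowski_adjoint (Y t) ** (Q t ** Z t) + minkowski_adjoint (P t ** Y t) ** Z t) (at t within {0..1})"
    by (intro matrix_mult.has_vector_derivative Z t
        bounded_linear.has_vector_derivative[OF bounded_linear_minkowski_adjoint] Y)
  also have "minkowski_adjoint (Y t) ** (Q t ** Z t) + minkowski_adjoint (P t ** Y t) ** Z t =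
      minkowski_adjoint (Y t) ** (Q t - P t) ** Z t"
    by (simp add: minkowski_adjoint_mult P[OF t] matrix_mult.diff_left matrix_mult.diff_right
        matrix_mult.minus_left matrix_mult.minus_right matrix_mul_assoc)
  finally show ?thesis .
qed

lemma minkowski_adjoint_ode_const:
  fixes Y Z :: "real \<Rightarrow> real^('n::finite option)^('n option)"
  assumes Y: "\<And>t. t \<in> {0..1} \<Longrightarrow> (Y has_vector_derivative P t ** Y t) (at t within {0..1})"
    and Z: "\<And>t. t \<in> {0..1} \<Longrightarrow> (Z has_vector_derivative P t ** Z t) (at t within {0..1})"
    and P: "\<And>t. t \<in> {0..1} \<Longrightarrow> minkowski_adjoint (P t) = - P t"
    and init: "Y 0 = mat 1" "Z 0 = mat 1" and t: "t \<in> {0..1}"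
  shows "minkowski_adjoint (Y t) ** Z t = mat 1"
proof -
  have "minkowski_adjoint (Y t) ** Z t = minkowski_adjoint (Y 0) ** Z 0"
    using minkowski_adjoint_ode[OF Y Z P] t
    by (intro has_derivative_zero_unique[of "{0..1}" "\<lambda>t. minkowski_adjoint (Y t) ** Z t"])
      (auto simp: has_vector_derivative_def)
  then show ?thesis
    by (simp add: init minkowski_adjoint_mat_1)
qed

lemma ode_unique:
  fixes Y Z :: "real \<Rightarrow> real^('n::finite option)^('n option)"
  assumes Y: "\<And>t. t \<in> {0..1} \<Longrightarrow> (Y has_vector_derivative P t ** Y t) (at t within {0..1})"
    and Z: "\<And>t. t \<in> {0..1} \<Longrightarrow> (Z has_vector_derivative P t ** Z t) (at t within {0..1})"
    and P: "\<And>t. t \<in> {0..1} \<Longrightarrow> minkowski_adjoint (P t) = - P t"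
    and init: "Y 0 = mat 1" "Z 0 = mat 1" and t: "t \<in> {0..1}"
  shows "Y t = Z t"
proof -
  have "Y t \<in> O1n"
    using minkowski_adjoint_ode_const[OF Y Y P init(1,1) t] by (simp add: O1n_iff_adjoint)
  then have "Y t ** minkowski_adjoint (Y t) = mat 1"
    by (rule O1n_adjoint)
  then have "Z t = Y t ** (minkowski_adjoint (Y t) ** Z t)"
    by (simp add: matrix_mul_assoc)
  then show ?thesis
    by (simp only: minkowski_adjoint_ode_const[OF Y Z P init t] matrix_mul_rid)
qed

section \<open>Lifts of curves as solutions of the transport equation\<close>

lemma minkowski_unit_curve_orthogonal:
  fixes x :: "real \<Rightarrow> real^('n::finite option)"
  assumes "(x has_vector_derivative v) (at t within {0..1})" "t \<in> {0..1}"
    and unit: "\<And>t. t \<in> {0..1} \<Longrightarrow> minkowski (x t) (x t) = -1"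
  shows "minkowski (x t) v = 0"
proof -
  have "((\<lambda>t. minkowski (x t) (x t)) has_vector_derivative
      minkowski (x t) v + minkowski v (x t)) (at t within {0..1})"
    by (intro minkowski.has_vector_derivative assms)
  moreover have "((\<lambda>t. minkowski (x t) (x t)) has_vector_derivative 0) (at t within {0..1})"
    by (rule has_vector_derivative_transform[of _ _ _ "\<lambda>_. -1"]) (use assms in auto)
  ultimately have "minkowski (x t) v + minkowski v (x t) = 0"
    using has_vector_derivative_unique_unit_interval assms(2) by blast
  then show ?thesis
    by (simp add: minkowski_commute)
qed

text \<open>For a velocity \<open>v\<close> tangent at \<open>x\<close>, the matrix of the equation
  sends \<open>x\<close> to \<open>v\<close>, because \<open>x\<close> has Minkowski square -1.
  Hence the inverse of \<open>Y t\<close> applied to \<open>x t\<close> has derivative zero and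
  stays at the base vector.\<close>

lemma wedge_ode_proj:
  fixes x v :: "real \<Rightarrow> real^('n::finite option)"
  assumes x: "\<And>t. t \<in> {0..1} \<Longrightarrow> (x has_vector_derivative v t) (at t within {0..1})"
    and unit: "\<And>t. t \<in> {0..1} \<Longrightarrow> minkowski (x t) (x t) = -1"
    and Y: "\<And>t. t \<in> {0..1} \<Longrightarrow>
      (Y has_vector_derivative minkowski_wedge (x t) (v t) ** Y t) (at t within {0..1})"
    and init: "Y 0 = mat 1" "x 0 = axis None 1" and t: "t \<in> {0..1}"
  shows "Y t \<in> O1n" "proj (Y t) = x t"
proof -
  have O: "Y t \<in> O1n" if "t \<in> {0..1}" for t
    using minkowski_adjoint_ode_const[OF Y Y minkowski_adjoint_wedge init(1,1) that]
    by (simp add: O1n_iff_adjoint)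
  have deriv: "((\<lambda>t. minkowski_adjoint (Y t) *v x t) has_vector_derivative 0) (at t within {0..1})"
    if t: "t \<in> {0..1}" for t
  proof -
    let ?P = "minkowski_wedge (x t) (v t)"
    have "minkowski (x t) (v t) = 0"
      by (rule minkowski_unit_curve_orthogonal[OF x[OF t] t unit])
    then have "?P *v x t = v t"
      by (simp add: minkowski_wedge_mult minkowski_commute[of "v t"] unit[OF t])
    then have "minkowski_adjoint (Y t) *v v t + minkowski_adjoint (?P ** Y t) *v x t = 0"
      by (simp add: minkowski_adjoint_mult minkowski_adjoint_wedge matrix_vector.minus_left
          matrix_vector.minus_right flip: matrix_vector_mul_assoc)
    moreover have "((\<lambda>t. minkowski_adjoint (Y t) *v x t) has_vector_derivative
        minkowski_adjoint (Y t) *v v t + minkowski_adjoint (?P ** Y t) *v x t) (at t within {0..1})"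
      by (intro matrix_vector.has_vector_derivative x Y t
          bounded_linear.has_vector_derivative[OF bounded_linear_minkowski_adjoint])
    ultimately show ?thesis by simp
  qed
  have "minkowski_adjoint (Y t) *v x t = minkowski_adjoint (Y 0) *v x 0"
    using deriv t
    by (intro has_derivative_zero_unique[of "{0..1}" "\<lambda>t. minkowski_adjoint (Y t) *v x t"])
      (auto simp: has_vector_derivative_def)
  then have "Y t *v (minkowski_adjoint (Y t) *v x t) = proj (Y t)"
    by (simp add: init minkowski_adjoint_mat_1 proj_def)
  then show "proj (Y t) = x t"
    by (simp add: matrix_vector_mul_assoc O1n_adjoint O[OF t])
  show "Y t \<in> O1n" by (rule O[OF t])
qed

text \<open>\<open>s\<close> selects a loop and \<open>t\<close> runs along it; the loop for
  \<open>s = 0\<close> is constant. The suffixes of \<open>xs\<close>, \<open>xt\<close>,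
  \<open>xst\<close> denote partial derivatives. The mixed one is given as the
  \<open>s\<close>-derivative of \<open>xt\<close>; the other order is derived in
  \<open>deriv_st\<close>.\<close>

locale loop_family =
  fixes x xs xt xst :: "real \<Rightarrow> real \<Rightarrow> real^('n::finite option)"
  assumes cont: "continuous_on ({0..1} \<times> {0..1}) (\<lambda>(s, t). x s t)"
      "continuous_on ({0..1} \<times> {0..1}) (\<lambda>(s, t). xs s t)"
      "continuous_on ({0..1} \<times> {0..1}) (\<lambda>(s, t). xt s t)"
      "continuous_on ({0..1} \<times> {0..1}) (\<lambda>(s, t). xst s t)"
    and deriv_t: "\<And>s t. s \<in> {0..1} \<Longrightarrow> t \<in> {0..1} \<Longrightarrow>
      ((\<lambda>t. x s t) has_vector_derivative xt s t) (at t within {0..1})"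
    and deriv_s: "\<And>s t. s \<in> {0..1} \<Longrightarrow> t \<in> {0..1} \<Longrightarrow>
      ((\<lambda>s. x s t) has_vector_derivative xs s t) (at s within {0..1})"
    and deriv_ts: "\<And>s t. s \<in> {0..1} \<Longrightarrow> t \<in> {0..1} \<Longrightarrow>
      ((\<lambda>s. xt s t) has_vector_derivative xst s t) (at s within {0..1})"
    and unit: "\<And>s t. s \<in> {0..1} \<Longrightarrow> t \<in> {0..1} \<Longrightarrow> minkowski (x s t) (x s t) = -1"
    and base: "\<And>s. s \<in> {0..1} \<Longrightarrow> x s 0 = axis None 1"
      "\<And>s. s \<in> {0..1} \<Longrightarrow> x s 1 = axis None 1"
      "\<And>t. t \<in> {0..1} \<Longrightarrow> x 0 t = axis None 1"
begin

lemma tangent: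
  assumes "s \<in> {0..1}" "t \<in> {0..1}"
  shows "minkowski (x s t) (xs s t) = 0" "minkowski (x s t) (xt s t) = 0"
  using minkowski_unit_curve_orthogonal[OF deriv_s[OF assms] assms(1)]
    minkowski_unit_curve_orthogonal[OF deriv_t[OF assms] assms(2)] unit assms by auto

lemma xs_base:
  assumes "s \<in> {0..1}"
  shows "xs s 0 = 0" "xs s 1 = 0"
proof -
  have "xs s t = 0" if "t \<in> {0..1}" and c: "\<And>s. s \<in> {0..1} \<Longrightarrow> x s t = axis None 1" for t
  proof (rule has_vector_derivative_unique_unit_interval[OF deriv_s[OF assms that(1)] _ assms])
    show "((\<lambda>s. x s t) has_vector_derivative 0) (at s within {0..1})"
      by (rule has_vector_derivative_transform[of _ _ _ "\<lambda>_. axis None 1"]) (use assms c in auto)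
  qed
  then show "xs s 0 = 0" "xs s 1 = 0"
    using base by auto
qed

text \<open>Symmetry of the mixed derivative: writing \<open>x s t\<close> as the base vector plus
  the integral of \<open>xt\<close> and differentiating under the integral sign gives
  \<open>xs\<close> as an integral of \<open>xst\<close>, to which the fundamental theorem
  applies.\<close>

lemma deriv_st:
  assumes s: "s \<in> {0..1}" and t: "t \<in> {0..1}"
  shows "((\<lambda>t. xs s t) has_vector_derivative xst s t) (at t within {0..1})"
proof -
  have xs_eq: "xs s t = integral {0..t} (xst s)" if t: "t \<in> {0..1}" for t
  proof (rule has_vector_derivative_unique_unit_interval[OF deriv_s[OF s t] _ s])
    have sub: "{0..t} \<subseteq> {0..1}" using t by auto
    have "((\<lambda>s. integral (cbox 0 t) (xt s)) has_vector_derivative integral (cbox 0 t) (xst s))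
        (at s within {0..1})"
    proof (rule leibniz_rule_vector_derivative[OF _ _ _ s])
      show "xt s integrable_on cbox 0 t" if "s \<in> {0..1}" for s
        using continuous_on_subset[OF continuous_on_section[OF cont(3) that] sub]
        by (simp add: integrable_continuous_real)
      show "continuous_on ({0..1} \<times> cbox 0 t) (\<lambda>(s, t). xst s t)"
        by (rule continuous_on_subset[OF cont(4)]) (use t in auto)
    qed (use t in \<open>auto intro!: deriv_ts\<close>)
    then have "((\<lambda>s. axis None 1 + integral {0..t} (xt s)) has_vector_derivative
        integral {0..t} (xst s)) (at s within {0..1})"
      by (auto intro!: derivative_eq_intros)
    then show "((\<lambda>s. x s t) has_vector_derivative integral {0..t} (xst s)) (at s within {0..1})"
    proof (rule has_vector_derivative_transform[OF s, rotated])
      fix s :: real assume s: "s \<in> {0..1}"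
      have "(xt s has_integral (x s t - x s 0)) {0..t}"
        by (rule fundamental_theorem_of_calculus)
          (use t sub in \<open>auto intro!: has_vector_derivative_within_subset[OF deriv_t[OF s] sub]\<close>)
      then show "x s t = axis None 1 + integral {0..t} (xt s)"
        by (simp add: has_integral_iff base(1)[OF s])
    qed
  qed
  have "((\<lambda>t. integral {0..t} (xst s)) has_vector_derivative xst s t) (at t within {0..1})"
    by (rule integral_has_vector_derivative[OF continuous_on_section[OF cont(4) s] t])
  then show ?thesis
    by (rule has_vector_derivative_transform[OF t, rotated]) (simp add: xs_eq)
qed

text \<open>\<open>P\<close> and \<open>Q\<close> are the components, in the directions
  \<open>t\<close> and \<open>s\<close>, of the matrix-valued one-form that governs horizontal lifts
  over the family. \<open>Ps\<close> is the \<open>s\<close>-derivative of \<open>P\<close>.\<close>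

definition "P s t = minkowski_wedge (x s t) (xt s t)"
definition "Q s t = minkowski_wedge (x s t) (xs s t)"
definition "Ps s t = minkowski_wedge (xs s t) (xt s t) + minkowski_wedge (x s t) (xst s t)"

lemma cont_P: "continuous_on ({0..1} \<times> {0..1}) (\<lambda>(s, t). P s t)"
  and cont_Ps: "continuous_on ({0..1} \<times> {0..1}) (\<lambda>(s, t). Ps s t)"
  using cont unfolding P_def Ps_def split_beta by (auto intro!: continuous_intros)

lemma deriv_P:
  assumes "s \<in> {0..1}" "t \<in> {0..1}"
  shows "((\<lambda>s. P s t) has_vector_derivative Ps s t) (at s within {0..1})"
  unfolding P_def Ps_def
  using minkowski_wedge.has_vector_derivative[OF deriv_s[OF assms] deriv_ts[OF assms]]
  by (simp add: add.commute)

lemma deriv_Q: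
  assumes "s \<in> {0..1}" "t \<in> {0..1}"
  shows "((\<lambda>t. Q s t) has_vector_derivative
    - minkowski_wedge (xs s t) (xt s t) + minkowski_wedge (x s t) (xst s t)) (at t within {0..1})"
  unfolding Q_def
  using minkowski_wedge.has_vector_derivative[OF deriv_t[OF assms] deriv_st[OF assms]]
  by (simp add: minkowski_wedge_commute[of "xt s t"])

text \<open>The bracket of two horizontal directions at \<open>x\<close> is a bivector of tangent
  vectors: this is where the curvature of hyperbolic space enters, through
  \<open>minkowski (x s t) (x s t) = -1\<close>. Applied to a vector, the mixed terms vanish by
  tangency.\<close>

lemma commutator:
  assumes "s \<in> {0..1}" "t \<in> {0..1}"
  shows "P s t ** Q s t - Q s t ** P s t = - minkowski_wedge (xs s t) (xt s t)"
proof -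
  have "minkowski (xs s t) (x s t) = 0" "minkowski (xt s t) (x s t) = 0"
    "minkowski (xt s t) (xs s t) = minkowski (xs s t) (xt s t)"
    using tangent[OF assms] by (simp_all add: minkowski_commute[of _ "x s t"] minkowski_commute[of "xt s t" "xs s t"])
  then show ?thesis
    using tangent[OF assms] unit[OF assms]
    by (simp add: matrix_eq P_def Q_def matrix_vector.diff_left matrix_vector.minus_left
        minkowski_wedge_mult matrix_vector_mult_diff_distrib matrix_vector_mult_scaleR
        minkowski.diff_right minkowski.scaleR_right algebra_simps
        flip: matrix_vector_mul_assoc)
qed

text \<open>The structure equation: the curvature of the connection pulled back by \<open>x\<close> is
  \<open>xs \<and> xt\<close>, up to the derivative of a term that vanishes at both endpoints.\<close>

lemma Ps_eq:
  assumes "s \<in> {0..1}" "t \<in> {0..1}"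
  shows "Ps s t = minkowski_wedge (xs s t) (xt s t) +
    ((- minkowski_wedge (xs s t) (xt s t) + minkowski_wedge (x s t) (xst s t))
      + Q s t ** P s t - P s t ** Q s t)"
  using commutator[OF assms] by (simp add: Ps_def algebra_simps)

text \<open>By variation of constants \<open>K\<close> is the integral of \<open>Ps\<close>
  conjugated by the lift. The structure equation replaces \<open>Ps\<close> by the curvature plus an
  exact derivative in \<open>t\<close> that integrates to zero, and what remains is bounded by the
  area density along the loop.\<close>

lemma transport_exists:
  obtains g h K where
    "\<And>s. g s 0 = mat 1"
    "\<And>s t. s \<in> {0..1} \<Longrightarrow> t \<in> {0..1} \<Longrightarrow>
      (g s has_vector_derivative minkowski_wedge (x s t) (xt s t) ** g s t) (at t within {0..1})"
    "\<And>s. h s = g s 1" "h 0 = mat 1" "\<And>s. s \<in> {0..1} \<Longrightarrow> h s \<in> SOn"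
    "continuous_on {0..1} K"
    "\<And>s. s \<in> {0..1} \<Longrightarrow> (h has_vector_derivative h s ** K s) (at s within {0..1})"
    "\<And>s. s \<in> {0..1} \<Longrightarrow> norm (K s) \<le> sqrt 2 * integral {0..1} (\<lambda>t. sqrt (gram (xs s t) (xt s t)))"
proof -
  obtain g where g: "continuous_on ({0..1} \<times> {0..1}) (\<lambda>(s, t). g s t)" "\<And>s. g s 0 = mat 1"
    "\<And>s t. s \<in> {0..1} \<Longrightarrow> t \<in> {0..1} \<Longrightarrow>
      (g s has_vector_derivative P s t ** g s t) (at t within {0..1})"
    using linear_ode_exists[OF _ cont_P] by (metis compact_Icc)
  have adjP: "minkowski_adjoint (P s t) = - P s t" for s t
    by (simp add: P_def minkowski_adjoint_wedge)
  have O: "g s t \<in> O1n" and proj: "proj (g s t) = x s t" if "s \<in> {0..1}" "t \<in> {0..1}" for s t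
    using wedge_ode_proj[OF deriv_t unit g(3)[unfolded P_def] g(2) base(1)] that by blast+
  define h where "h s = g s 1" for s
  define N where "N s t = minkowski_adjoint (g s t) ** Ps s t ** g s t" for s t
  define K where "K s = integral {0..1} (N s)" for s
  \<comment> \<open>The curvature at the point \<open>x s t\<close>, carried back to the base point
    along the lift.\<close>
  define R where "R s t = minkowski_adjoint (g s t) ** minkowski_wedge (xs s t) (xt s t) ** g s t" for s t
  have contN: "continuous_on ({0..1} \<times> {0..1}) (\<lambda>(s, t). N s t)"
    using g(1) cont_Ps unfolding N_def split_beta by (intro continuous_intros)
  have contR: "continuous_on ({0..1} \<times> {0..1}) (\<lambda>(s, t). R s t)"
    using g(1) cont(2,3) unfolding R_def split_beta by (intro continuous_intros)
  have contK: "continuous_on {0..1} K"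
    using integral_continuous_on_param[of "{0..1}" 0 1 N] contN by (simp add: K_def)
  have h_SOn: "h s \<in> SOn" if s: "s \<in> {0..1}" for s
  proof (rule SO1n_stabilizer)
    show "h s \<in> SO1n" unfolding h_def
      by (rule SO1n_path[OF continuous_on_section[OF g(1) s] g(2)]) (use O s in auto)
    show "proj (h s) = axis None 1"
      using proj[OF s, of 1] base(2)[OF s] by (simp add: h_def)
  qed
  have h0: "h 0 = mat 1"
  proof -
    have "xt 0 t = 0" if t: "t \<in> {0..1}" for t
    proof (rule has_vector_derivative_unique_unit_interval[OF deriv_t[OF _ t] _ t])
      show "((\<lambda>t. x 0 t) has_vector_derivative 0) (at t within {0..1})"
        by (rule has_vector_derivative_transform[of _ _ _ "\<lambda>_. axis None 1"]) (use t base in auto)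
    qed auto
    then have P0: "P 0 t = 0" if "t \<in> {0..1}" for t
      using that by (simp add: P_def minkowski_wedge.zero_right)
    have "g 0 1 = mat 1"
    proof (rule ode_unique[where P = "P 0" and Z = "\<lambda>_. mat 1"])
      show "((\<lambda>_. mat 1) has_vector_derivative P 0 t ** mat 1) (at t within {0..1})"
        if "t \<in> {0..1}" for t
        using that by (simp add: P0)
    qed (auto intro!: g adjP)
    then show ?thesis by (simp add: h_def)
  qed
  have K_eq: "K s = integral {0..1} (R s)" if s: "s \<in> {0..1}" for s
  proof -
    \<comment> \<open>\<open>D\<close> is the derivative of \<open>Q\<close> conjugated by the lift.
      Since the loops share their endpoints, \<open>Q\<close> vanishes at \<open>t = 0\<close> and
      \<open>t = 1\<close>, and so does the integral of \<open>D\<close>.\<close>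
    define D where "D t = minkowski_adjoint (g s t) **
      ((- minkowski_wedge (xs s t) (xt s t) + minkowski_wedge (x s t) (xst s t))
      + Q s t ** P s t - P s t ** Q s t) ** g s t" for t
    have "(D has_integral (minkowski_adjoint (g s 1) ** (Q s 1 ** g s 1) - minkowski_adjoint (g s 0) ** (Q s 0 ** g s 0))) {0..1}"
    proof (rule fundamental_theorem_of_calculus)
      fix t :: real assume t: "t \<in> {0..1}"
      let ?W = "- minkowski_wedge (xs s t) (xt s t) + minkowski_wedge (x s t) (xst s t)"
      have "((\<lambda>t. minkowski_adjoint (g s t) ** (Q s t ** g s t)) has_vector_derivative
        minkowski_adjoint (g s t) ** (Q s t ** (P s t ** g s t) + ?W ** g s t) +
        minkowski_adjoint (P s t ** g s t) ** (Q s t ** g s t)) (at t within {0..1})"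
        by (intro matrix_mult.has_vector_derivative g(3) deriv_Q s t
          bounded_linear.has_vector_derivative[OF bounded_linear_minkowski_adjoint])
      also have "minkowski_adjoint (g s t) ** (Q s t ** (P s t ** g s t) + ?W ** g s t) +
        minkowski_adjoint (P s t ** g s t) ** (Q s t ** g s t) = D t"
        by (simp add: D_def minkowski_adjoint_mult adjP matrix_mult.diff_left matrix_mult.diff_right
            matrix_mult.add_left matrix_mult.add_right matrix_mult.minus_left matrix_mult.minus_right
            matrix_mul_assoc)
      finally show "((\<lambda>t. minkowski_adjoint (g s t) ** (Q s t ** g s t)) has_vector_derivative D t) (at t within {0..1})" .
    qed simp
    then have "(D has_integral 0) {0..1}"
      by (simp add: Q_def xs_base[OF s] minkowski_wedge.zero_right matrix_mult.zero_left matrix_mult.zero_right)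
    moreover have "(R s has_integral integral {0..1} (R s)) {0..1}"
      using continuous_on_section[OF contR s] by (simp add: integrable_continuous_real integrable_integral)
    ultimately have "((\<lambda>t. R s t + D t) has_integral integral {0..1} (R s) + 0) {0..1}"
      by (intro has_integral_add)
    moreover have "R s t + D t = N s t" if "t \<in> {0..1}" for t
      unfolding R_def D_def N_def Ps_eq[OF s that] by (simp only: matrix_mult.add_left matrix_mult.add_right)
    ultimately have "(N s has_integral integral {0..1} (R s)) {0..1}"
      by (metis (no_types, lifting) has_integral_cong add_0_right)
    then show ?thesis
      by (simp add: K_def has_integral_iff)
  qed
  \<comment> \<open>With \<open>h s0\<close> factored out, \<open>h s - h s0\<close> is exactly
    \<open>s - s0\<close> times a continuous function \<open>\<Psi>\<close> of \<open>s\<close>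
    whose value at \<open>s0\<close> is \<open>K s0\<close>; no remainder has to be
    estimated.\<close>
  have deriv_h: "(h has_vector_derivative h s0 ** K s0) (at s0 within {0..1})" if s0: "s0 \<in> {0..1}" for s0
  proof -
    define seg where "seg s r = s0 + r * (s - s0)" for s r :: real
    have seg: "seg s r \<in> {0..1}" if "s \<in> {0..1}" "r \<in> {0..1}" for s r
    proof -
      have "seg s r = (1 - r) *\<^sub>R s0 + r *\<^sub>R s" by (simp add: seg_def algebra_simps)
      then show ?thesis
        using convexD_alt[OF convex_real_interval(5) s0 that(1), of r] that(2) by simp
    qed
    \<comment> \<open>Hadamard's lemma: the mean of \<open>Ps\<close> over the segment from
      \<open>s0\<close> to \<open>s\<close> is the difference quotient of \<open>P\<close> in a form
      that stays continuous at \<open>s = s0\<close>.\<close>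
    define D where "D s t = integral (cbox 0 1) (\<lambda>r. Ps (seg s r) t)" for s t
    have contD: "continuous_on ({0..1} \<times> {0..1}) (\<lambda>(s, t). D s t)"
      unfolding D_def split_beta
    proof (rule integral_continuous_on_param)
      have "continuous_on (({0..1} \<times> {0..1}) \<times> cbox 0 1) (\<lambda>q. Ps (seg (fst (fst q)) (snd q)) (snd (fst q)))"
        by (rule continuous_on_compose2[OF cont_Ps[unfolded split_beta], of _
            "\<lambda>q. (seg (fst (fst q)) (snd q), snd (fst q))", unfolded fst_conv snd_conv])
          (use seg in \<open>auto simp: seg_def intro!: continuous_intros\<close>)
      then show "continuous_on (({0..1} \<times> {0..1}) \<times> cbox 0 1) (\<lambda>(p, r). Ps (seg (fst p) r) (snd p))"
        by (simp add: split_beta)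
    qed
    have D: "P s t - P s0 t = (s - s0) *\<^sub>R D s t" if s: "s \<in> {0..1}" and t: "t \<in> {0..1}" for s t
    proof -
      have "((\<lambda>r. (s - s0) *\<^sub>R Ps (seg s r) t) has_integral (P (seg s 1) t - P (seg s 0) t)) {0..1}"
      proof (rule fundamental_theorem_of_calculus)
        fix r :: real assume r: "r \<in> {0..1}"
        have "(((\<lambda>s. P s t) \<circ> seg s) has_vector_derivative (s - s0) *\<^sub>R Ps (seg s r) t) (at r within {0..1})"
        proof (rule vector_diff_chain_within)
          show "(seg s has_vector_derivative (s - s0)) (at r within {0..1})"
            unfolding seg_def has_real_derivative_iff_has_vector_derivative[symmetric]
            by (auto intro!: derivative_eq_intros)
          show "((\<lambda>s. P s t) has_vector_derivative Ps (seg s r) t) (at (seg s r) within seg s ` {0..1})"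
            by (rule has_vector_derivative_within_subset[OF deriv_P[OF seg[OF s r] t]]) (use seg s in auto)
        qed
        then show "((\<lambda>r. P (seg s r) t) has_vector_derivative (s - s0) *\<^sub>R Ps (seg s r) t) (at r within {0..1})"
          by (simp add: o_def)
      qed simp
      then have "integral {0..1} (\<lambda>r. (s - s0) *\<^sub>R Ps (seg s r) t) = P s t - P s0 t"
        by (simp add: has_integral_iff seg_def)
      then show ?thesis by (simp add: D_def)
    qed
    define \<Psi> where "\<Psi> s = integral {0..1} (\<lambda>t. minkowski_adjoint (g s0 t) ** D s t ** g s t)" for s
    have "continuous_on ({0..1} \<times> {0..1}) (\<lambda>p. g s0 (snd p))"
      by (rule continuous_on_compose2[OF continuous_on_section[OF g(1) s0]]) (auto intro: continuous_intros)
    then have "continuous_on ({0..1} \<times> {0..1}) (\<lambda>(s, t). minkowski_adjoint (g s0 t) ** D s t ** g s t)"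
      using g(1) contD unfolding split_beta by (intro continuous_intros)
    then have cont\<Psi>: "continuous_on {0..1} \<Psi>"
      using integral_continuous_on_param[of "{0..1}" 0 1 "\<lambda>s t. minkowski_adjoint (g s0 t) ** D s t ** g s t"]
      by (simp add: \<Psi>_def)
    have \<Psi>0: "\<Psi> s0 = K s0"
      unfolding \<Psi>_def K_def N_def D_def seg_def by simp
    have "h s - h s0 = (s - s0) *\<^sub>R (h s0 ** \<Psi> s)" if s: "s \<in> {0..1}" for s
    proof -
      have "((\<lambda>t. minkowski_adjoint (g s0 t) ** (P s t - P s0 t) ** g s t) has_integral
          (minkowski_adjoint (g s0 1) ** g s 1 - minkowski_adjoint (g s0 0) ** g s 0)) {0..1}"
        by (rule fundamental_theorem_of_calculus) (auto intro!: minkowski_adjoint_ode g s s0 adjP)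
      then have "minkowski_adjoint (h s0) ** h s - mat 1 =
          integral {0..1} (\<lambda>t. minkowski_adjoint (g s0 t) ** (P s t - P s0 t) ** g s t)"
        by (simp add: has_integral_iff h_def g(2) minkowski_adjoint_mat_1)
      also have "\<dots> = integral {0..1} (\<lambda>t. (s - s0) *\<^sub>R (minkowski_adjoint (g s0 t) ** D s t ** g s t))"
        by (intro integral_cong) (simp add: D[OF s] matrix_mult.scaleR_left matrix_mult.scaleR_right)
      also have "\<dots> = (s - s0) *\<^sub>R \<Psi> s"
        by (simp add: \<Psi>_def)
      finally have "h s0 ** (minkowski_adjoint (h s0) ** h s - mat 1) = h s0 ** ((s - s0) *\<^sub>R \<Psi> s)"
        by simp
      then show ?thesis
        using O1n_adjoint(2)[OF O[OF s0, of 1]]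
        by (simp add: matrix_mult.diff_right matrix_mul_assoc h_def matrix_mult.scaleR_right)
    qed
    then have "(h has_vector_derivative h s0 ** \<Psi> s0) (at s0 within {0..1})"
      by (rule has_vector_derivative_caratheodory) (use s0 in \<open>auto intro!: continuous_intros cont\<Psi>\<close>)
    then show ?thesis by (simp add: \<Psi>0)
  qed
  have normK: "norm (K s) \<le> sqrt 2 * integral {0..1} (\<lambda>t. sqrt (gram (xs s t) (xt s t)))"
    if s: "s \<in> {0..1}" for s
  proof -
    have normR: "norm (R s t) = sqrt 2 * sqrt (gram (xs s t) (xt s t))" if t: "t \<in> {0..1}" for t
    proof -
      have "gram (xs s t) (xt s t) = lie_inner (R s t) (R s t)"
        unfolding R_def
        by (rule gram_tangent[OF O[OF s t] _ tangent[OF s t]])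
          (use proj[OF s t] in \<open>simp add: proj_def\<close>)
      then have "2 * gram (xs s t) (xt s t) = (norm (R s t))\<^sup>2"
        by (simp add: lie_inner_self)
      then show ?thesis
        by (metis norm_ge_zero real_sqrt_abs real_sqrt_mult abs_of_nonneg)
    qed
    have "norm (K s) \<le> integral {0..1} (\<lambda>t. norm (R s t))"
      unfolding K_eq[OF s]
      by (intro integral_norm_bound_integral integrable_continuous_real continuous_intros
          continuous_on_section[OF contR s]) auto
    also have "\<dots> = integral {0..1} (\<lambda>t. sqrt 2 * sqrt (gram (xs s t) (xt s t)))"
      by (intro integral_cong normR)
    finally show ?thesis by simp
  qed
  show ?thesis
    by (rule that[of g h K]) (use g h0 h_SOn contK deriv_h normK in \<open>auto simp: h_def P_def\<close>)
qed

end

section \<open>Lengthening a curve in the rotation group\<close>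

lemma SOn_subset:
  assumes "k \<in> SOn"
  shows "k \<in> O1n" "proj k = axis None 1"
proof -
  obtain B where B: "k = block 1 B" "transpose B ** B = mat 1"
    using assms by (auto simp: SOn_def rotation_matrix_def orthogonal_matrix)
  have "(\<Sum>l\<in>UNIV. B $ l $ i * B $ l $ j) = (if i = j then 1 else 0)" for i j
    using B(2) unfolding vec_eq_iff transpose_mult_nth by (simp add: mat_def)
  then show "k \<in> O1n"
    by (auto simp: O1n_component_iff split_option_all B(1) block_def)
  show "proj k = axis None 1"
    by (auto simp: B(1) vec_eq_iff proj_nth block_def axis_def split: option.split)
qed

text \<open>Left invariance removes the factor \<open>f t\<close> from the speed, and the norm of
  \<open>W t\<close> divided by \<open>sqrt 2\<close> is left.\<close>

lemma curve_length_eq: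
  assumes deriv: "\<And>t. t \<in> {0..1} \<Longrightarrow> (f has_vector_derivative f t ** W t) (at t within {0..1})"
    and O: "\<And>t. t \<in> {0..1} \<Longrightarrow> f t \<in> O1n"
  shows "curve_length f = integral {0..1} (\<lambda>t. norm (W t)) / sqrt 2"
proof -
  have "curve_length f = integral {0..1} (\<lambda>t. norm (W t) / sqrt 2)"
    unfolding curve_length_def Let_def
  proof (rule integral_cong)
    fix t :: real assume t: "t \<in> {0..1}"
    have "vector_derivative f (at t within {0..1}) = f t ** W t"
      by (rule vector_derivative_within_closed_interval) (use t deriv[OF t] in auto)
    then show "sqrt (left_inner (f t) (vector_derivative f (at t within {0..1}))
        (vector_derivative f (at t within {0..1}))) = norm (W t) / sqrt 2"
      by (simp add: left_inner_mult[OF O[OF t]] lie_inner_self real_sqrt_divide)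
  qed
  then show ?thesis by simp
qed

text \<open>Rodrigues' formula for the exponential of \<open>\<alpha> *\<^sub>R E\<close>, valid
  when the cube of \<open>E\<close> is \<open>- E\<close>.\<close>

definition plane_rotation :: "real^'m^'m \<Rightarrow> real \<Rightarrow> real^'m^'m" where
  "plane_rotation E \<alpha> = mat 1 + sin \<alpha> *\<^sub>R E + (1 - cos \<alpha>) *\<^sub>R (E ** E)"

lemma plane_rotation_0: "plane_rotation E 0 = mat 1"
  by (simp add: plane_rotation_def)

lemma plane_rotation_deriv:
  assumes "E ** E ** E = - E"
  shows "(plane_rotation E has_vector_derivative plane_rotation E \<alpha> ** E) (at \<alpha> within S)"
proof -
  have "plane_rotation E \<alpha> ** E = cos \<alpha> *\<^sub>R E + sin \<alpha> *\<^sub>R (E ** E)"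
    by (simp add: plane_rotation_def matrix_mult.add_left matrix_mult.diff_left matrix_mult.scaleR_left assms algebra_simps)
  moreover have "((\<lambda>\<alpha>. mat 1 + sin \<alpha> *\<^sub>R E + (1 - cos \<alpha>) *\<^sub>R (E ** E)) has_vector_derivative
      0 + cos \<alpha> *\<^sub>R E + sin \<alpha> *\<^sub>R (E ** E)) (at \<alpha> within S)"
    unfolding has_vector_derivative_def
    by (auto intro!: derivative_eq_intros simp: algebra_simps)
  ultimately show ?thesis
    unfolding plane_rotation_def[abs_def] by simp
qed

lemma plane_rotation_O1n:
  fixes E :: "real^('n::finite option)^('n option)"
  assumes E: "E ** E ** E = - E" and adj: "minkowski_adjoint E = - E"
  shows "plane_rotation E \<alpha> \<in> O1n"
proof -
  have "minkowski_adjoint (plane_rotation E \<alpha>) = mat 1 - sin \<alpha> *\<^sub>R E + (1 - cos \<alpha>) *\<^sub>R (E ** E)"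
    by (simp add: plane_rotation_def linear_add[OF bounded_linear.linear[OF bounded_linear_minkowski_adjoint]]
        linear_cmul[OF bounded_linear.linear[OF bounded_linear_minkowski_adjoint]]
        minkowski_adjoint_mat_1 minkowski_adjoint_mult adj matrix_mult.minus_left matrix_mult.minus_right)
  moreover have "E ** (E ** E) = - E" "(E ** E) ** (E ** E) = - (E ** E)"
    using E by (simp_all add: matrix_mul_assoc matrix_mult.minus_left)
  \<comment> \<open>The odd powers of \<open>E\<close> cancel and the fourth power is minus the
    square. With \<open>s = sin \<alpha>\<close> and \<open>d = 1 - cos \<alpha>\<close> the
    remaining coefficient vanishes by the Pythagorean identity.\<close>
  moreover have "(mat 1 - s *\<^sub>R E + d *\<^sub>R (E ** E)) ** (mat 1 + s *\<^sub>R E + d *\<^sub>R (E ** E)) =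
      mat 1 + (2 * d - d\<^sup>2 - s\<^sup>2) *\<^sub>R (E ** E)" for s d
    using calculation(2,3)
    by (simp add: matrix_mult.add_left matrix_mult.diff_left matrix_mult.add_right matrix_mult.diff_right
        matrix_mult.scaleR_left matrix_mult.scaleR_right E)
      (simp add: vec_eq_iff power2_eq_square algebra_simps)
  ultimately have "minkowski_adjoint (plane_rotation E \<alpha>) ** plane_rotation E \<alpha> =
      mat 1 + (2 * (1 - cos \<alpha>) - (1 - cos \<alpha>)\<^sup>2 - (sin \<alpha>)\<^sup>2) *\<^sub>R (E ** E)"
    by (simp only: plane_rotation_def)
  also have "2 * (1 - cos \<alpha>) - (1 - cos \<alpha>)\<^sup>2 - (sin \<alpha>)\<^sup>2 = 0"
    using sin_cos_squared_add[of \<alpha>] by (simp add: power2_eq_square algebra_simps)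
  finally show ?thesis
    by (simp add: O1n_iff_adjoint)
qed

text \<open>The bivector of two distinct space axes, which exist because the dimension is at least
  2. It annihilates the time axis, so the rotations it generates fix the base point.\<close>

lemma rotation_generator_exists:
  assumes "CARD('n::finite) \<ge> 2"
  obtains E :: "real^('n::finite option)^('n option)" where "E ** E ** E = - E" "minkowski_adjoint E = - E"
    "E *v axis None 1 = 0" "E \<noteq> 0"
proof -
  obtain i j :: 'n where ij: "i \<noteq> j"
    using assms by (metis card_le_Suc0_iff_eq finite_class.finite_UNIV UNIV_I not_less_eq_eq numeral_2_eq_2)
  define u v :: "real^('n option)" where "u = axis (Some i) 1" and "v = axis (Some j) 1"
  define E where "E = minkowski_wedge u v"
  have mu: "minkowski u y = y $ Some i" and mv: "minkowski v y = y $ Some j" for y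
    by (simp_all add: minkowski_eq u_def v_def axis_def if_distrib[where f = "\<lambda>a. a * b" for b] cong: if_cong)
  have uv: "u $ Some i = 1" "u $ Some j = 0" "v $ Some i = 0" "v $ Some j = 1"
    using ij by (auto simp: u_def v_def axis_def)
  have Ey: "E *v y = (y $ Some j) *\<^sub>R u - (y $ Some i) *\<^sub>R v" for y
    by (simp add: E_def minkowski_wedge_mult mu mv)
  have "E ** E ** E = - E"
    by (simp add: matrix_eq matrix_vector.minus_left Ey uv flip: matrix_vector_mul_assoc)
  moreover have "E *v axis None 1 = 0"
    by (simp add: Ey axis_def)
  moreover have "E *v v = u" "u \<noteq> 0"
    using uv by (auto simp: Ey)
  then have "E \<noteq> 0" by auto
  ultimately show ?thesis
    using that[of E] by (auto simp: E_def minkowski_adjoint_wedge)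
qed

text \<open>The rotation angle \<open>l * (t * (1 - t))\<close> vanishes at both ends, so the
  endpoints of \<open>h\<close> are kept for every amplitude \<open>l\<close>. The length depends
  continuously on \<open>l\<close>, is at most \<open>A\<close> for \<open>l = 0\<close>, and grows
  without bound.\<close>

lemma lengthen_curve:
  fixes h K :: "real \<Rightarrow> real^('n::finite option)^('n option)"
  assumes card: "CARD('n) \<ge> 2"
    and h: "\<And>t. t \<in> {0..1} \<Longrightarrow> h t \<in> SOn" "h 0 = mat 1"
      "\<And>t. t \<in> {0..1} \<Longrightarrow> (h has_vector_derivative h t ** K t) (at t within {0..1})"
    and K: "continuous_on {0..1} K" "integral {0..1} (\<lambda>t. norm (K t)) / sqrt 2 \<le> A"
  obtains f where "C1_curve f" "\<And>t. t \<in> {0..1} \<Longrightarrow> f t \<in> SOn" "f 0 = mat 1" "f 1 = h 1"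
    "curve_length f = A"
proof -
  obtain E :: "real^('n option)^('n option)" where E: "E ** E ** E = - E" "minkowski_adjoint E = - E"
    "E *v axis None 1 = 0" "E \<noteq> 0"
    using rotation_generator_exists[OF card] .
  define R where "R = plane_rotation E"
  have O: "R \<alpha> \<in> O1n" for \<alpha>
    unfolding R_def by (rule plane_rotation_O1n[OF E(1,2)])
  have R_cont: "continuous_on S (\<lambda>p. R (u p))" if "continuous_on S u" for S and u :: "'z::t2_space \<Rightarrow> real"
    unfolding R_def plane_rotation_def using that by (intro continuous_intros)
  have Rproj: "R \<alpha> *v axis None 1 = axis None 1" for \<alpha>
    by (simp add: R_def plane_rotation_def matrix_vector.add_left matrix_vector.scaleR_left E(3)
        flip: matrix_vector_mul_assoc)
  \<comment> \<open>The velocity of the product curve \<open>f l\<close>, translated back to the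
    identity: the angular speed times \<open>E\<close>, plus \<open>K t\<close> conjugated by the
    rotation.\<close>
  define W where "W l t = (l * (1 - 2 * t)) *\<^sub>R E +
     minkowski_adjoint (R (l * (t * (1 - t)))) ** K t ** R (l * (t * (1 - t)))" for l t
  define f where "f l t = h t ** R (l * (t * (1 - t)))" for l t
  have f_deriv: "(f l has_vector_derivative f l t ** W l t) (at t within {0..1})" if t: "t \<in> {0..1}" for l t
  proof -
    let ?\<alpha> = "l * (t * (1 - t))"
    have "((R \<circ> (\<lambda>t. l * (t * (1 - t)))) has_vector_derivative (l * (1 - 2 * t)) *\<^sub>R (R ?\<alpha> ** E)) (at t within {0..1})"
      unfolding R_def
    proof (rule vector_diff_chain_within[OF _ plane_rotation_deriv[OF E(1)]])
      show "((\<lambda>t. l * (t * (1 - t))) has_vector_derivative l * (1 - 2 * t)) (at t within {0..1})"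
        unfolding has_real_derivative_iff_has_vector_derivative[symmetric]
        by (auto intro!: derivative_eq_intros simp: algebra_simps)
    qed
    from matrix_mult.has_vector_derivative[OF h(3)[OF t] this]
    have "(f l has_vector_derivative h t ** ((l * (1 - 2 * t)) *\<^sub>R (R ?\<alpha> ** E)) + h t ** K t ** R ?\<alpha>) (at t within {0..1})"
      by (simp add: f_def[abs_def] o_def)
    also have "h t ** ((l * (1 - 2 * t)) *\<^sub>R (R ?\<alpha> ** E)) + h t ** K t ** R ?\<alpha> = f l t ** W l t"
    proof -
      have "h t ** R ?\<alpha> ** (minkowski_adjoint (R ?\<alpha>) ** K t ** R ?\<alpha>) =
          h t ** (R ?\<alpha> ** minkowski_adjoint (R ?\<alpha>)) ** K t ** R ?\<alpha>"
        by (simp only: matrix_mul_assoc)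
      then show ?thesis
        by (simp add: f_def W_def matrix_mult.add_right matrix_mult.scaleR_right O1n_adjoint[OF O] matrix_mul_assoc)
    qed
    finally show ?thesis .
  qed
  have fO: "f l t \<in> O1n" if "t \<in> {0..1}" for l t
    unfolding f_def using SOn_subset(1)[OF h(1)[OF that]] O by (rule O1n_mult)
  have f_cont: "continuous_on {0..1} (f l)" for l
    by (rule continuous_on_vector_derivative[of _ _ "\<lambda>t. f l t ** W l t"]) (rule f_deriv)
  have f0: "f l 0 = mat 1" and f1: "f l 1 = h 1" for l
    by (simp_all add: f_def h(2) R_def plane_rotation_0)
  have f_SOn: "f l t \<in> SOn" if t: "t \<in> {0..1}" for l t
  proof (rule SO1n_stabilizer)
    show "f l t \<in> SO1n"
      by (rule SO1n_path[OF f_cont f0 fO t])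
    show "proj (f l t) = axis None 1"
      using SOn_subset(2)[OF h(1)[OF t]] by (simp add: f_def proj_def Rproj flip: matrix_vector_mul_assoc)
  qed
  have W_cont: "continuous_on (S \<times> {0..1}) (\<lambda>(l, t). W l t)" for S
  proof -
    have "continuous_on (S \<times> {0..1}) (\<lambda>p. K (snd p))"
      by (rule continuous_on_compose2[OF K(1)]) (auto intro: continuous_intros)
    moreover have "continuous_on (S \<times> {0..1}) (\<lambda>p. R (fst p * (snd p * (1 - snd p))))"
      by (rule R_cont) (intro continuous_intros)
    ultimately show ?thesis
      unfolding W_def split_beta
      by (intro continuous_on_add continuous_on_scaleR continuous_on_mult continuous_on_diff
          continuous_on_const continuous_on_fst continuous_on_snd continuous_on_id
          continuous_on_matrix_mult continuous_on_minkowski_adjoint)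
  qed
  have C1: "C1_curve (f l)" for l
    unfolding C1_curve_def
    using f_deriv[of _ l]
    by (intro exI[of _ "\<lambda>t. f l t ** W l t"] conjI ballI continuous_intros f_cont
        continuous_on_section[OF W_cont[of UNIV] UNIV_I]) auto
  define L where "L l = integral {0..1} (\<lambda>t. norm (W l t)) / sqrt 2" for l
  have len: "curve_length (f l) = L l" for l
    unfolding L_def by (rule curve_length_eq[OF f_deriv fO])
  have L_cont: "continuous_on S L" for S
  proof -
    have "continuous_on (S \<times> cbox 0 1) (\<lambda>(l, t). norm (W l t))"
      using W_cont[of S] unfolding split_beta cbox_interval by (rule continuous_on_norm)
    from integral_continuous_on_param[OF this] show ?thesis
      unfolding L_def by (auto intro!: continuous_intros)
  qed
  have "W 0 t = K t" for t
    by (simp add: W_def R_def plane_rotation_0 minkowski_adjoint_mat_1)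
  then have L0: "L 0 \<le> A"
    using K(2) by (simp add: L_def)
  \<comment> \<open>The bound is independent of \<open>l\<close>, because the amplitude enters this
    term only through a sine and a cosine; the term is thus a value of \<open>G\<close> on a compact
    set.\<close>
  obtain C where C: "\<And>l t. t \<in> {0..1} \<Longrightarrow>
      norm (minkowski_adjoint (R (l * (t * (1 - t)))) ** K t ** R (l * (t * (1 - t)))) \<le> C"
  proof -
    define G where "G p = (case p of (c, s, t) \<Rightarrow>
      minkowski_adjoint (mat 1 + s *\<^sub>R E + (1 - c) *\<^sub>R (E ** E)) ** K t **
        (mat 1 + s *\<^sub>R E + (1 - c) *\<^sub>R (E ** E)))" for p
    let ?B = "{-1..1::real} \<times> {-1..1::real} \<times> {0..1::real}"
    have "continuous_on ?B (\<lambda>p. K (snd (snd p)))"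
      by (rule continuous_on_compose2[OF K(1)]) (auto intro!: continuous_intros)
    then have "continuous_on ?B G"
      unfolding G_def split_beta by (intro continuous_intros)
    then have "bounded (G ` ?B)"
      by (intro compact_imp_bounded compact_continuous_image compact_Times) auto
    then obtain C where C: "\<And>p. p \<in> ?B \<Longrightarrow> norm (G p) \<le> C"
      unfolding bounded_iff by blast
    show ?thesis
    proof (rule that)
      fix l t :: real assume "t \<in> {0..1}"
      with C[of "(cos (l * (t * (1 - t))), sin (l * (t * (1 - t))), t)"]
      show "norm (minkowski_adjoint (R (l * (t * (1 - t)))) ** K t ** R (l * (t * (1 - t)))) \<le> C"
        by (simp add: G_def R_def plane_rotation_def)
    qed
  qed
  \<comment> \<open>The integral of the square of \<open>1 - 2 * t\<close> over the unit interval is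
    1/3. With this \<open>l\<close> the lower bound below integrates to
    \<open>sqrt 2 * \<bar>A\<bar>\<close>, so that the length is at least
    \<open>\<bar>A\<bar>\<close>.\<close>
  define l where "l = 3 * (sqrt 2 * \<bar>A\<bar> + \<bar>C\<bar>) / norm E"
  have l: "l \<ge> 0" and lE: "l * norm E = 3 * (sqrt 2 * \<bar>A\<bar> + \<bar>C\<bar>)"
    using E(4) by (simp_all add: l_def)
  have I: "((\<lambda>t. l * norm E * (1 - 2 * t)\<^sup>2 - \<bar>C\<bar>) has_integral
      (- (l * norm E * (1 - 2 * 1) ^ 3 / 6) - \<bar>C\<bar> * 1) - (- (l * norm E * (1 - 2 * 0) ^ 3 / 6) - \<bar>C\<bar> * 0)) {0..1}"
    by (rule fundamental_theorem_of_calculus)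
      (auto intro!: derivative_eq_intros simp: power2_eq_square simp flip: has_real_derivative_iff_has_vector_derivative)
  have "sqrt 2 * \<bar>A\<bar> \<le> integral {0..1} (\<lambda>t. l * norm E * (1 - 2 * t)\<^sup>2 - \<bar>C\<bar>)"
    using I lE by (simp add: has_integral_iff add_divide_distrib diff_divide_distrib)
  also have "\<dots> \<le> integral {0..1} (\<lambda>t. norm (W l t))"
  proof (intro integral_le integrable_continuous_real)
    show "continuous_on {0..1} (\<lambda>t. norm (W l t))"
      by (intro continuous_intros continuous_on_section[OF W_cont[of UNIV]]) auto
    fix t :: real assume t: "t \<in> {0..1}"
    \<comment> \<open>The absolute value is replaced by a smaller polynomial, whose integral follows
      from an antiderivative.\<close>
    have "(1 - 2 * t)\<^sup>2 \<le> \<bar>1 - 2 * t\<bar>"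
      using mult_left_le[of "\<bar>1 - 2 * t\<bar>" "\<bar>1 - 2 * t\<bar>"] t by (auto simp: power2_eq_square abs_mult[symmetric])
    then have "l * norm E * (1 - 2 * t)\<^sup>2 \<le> l * norm E * \<bar>1 - 2 * t\<bar>"
      using l by (intro mult_left_mono) auto
    also have "\<dots> = norm ((l * (1 - 2 * t)) *\<^sub>R E)"
      using l by (simp add: abs_mult)
    finally show "l * norm E * (1 - 2 * t)\<^sup>2 - \<bar>C\<bar> \<le> norm (W l t)"
      using C[OF t, of l] norm_diff_ineq[of "(l * (1 - 2 * t)) *\<^sub>R E"
        "minkowski_adjoint (R (l * (t * (1 - t)))) ** K t ** R (l * (t * (1 - t)))"]
      by (simp add: W_def)
  qed (auto intro!: continuous_intros)
  finally have "\<bar>A\<bar> \<le> L l"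
    by (simp add: L_def field_simps)
  then obtain m where "L m = A"
    using IVT'[of L 0 A l] L0 l L_cont by (metis abs_ge_self order_trans)
  then show ?thesis
    using that[of "f m"] C1 f_SOn f0 f1 len by simp
qed

section \<open>Disks in hyperbolic space\<close>

text \<open>The change of variables takes place on \<open>real^2\<close>, the iterated integral on
  \<open>real \<times> real\<close>. The coordinate bijection maps boxes to boxes of equal content
  in both directions, hence preserves integrals.\<close>

lemma integral_cart_2:
  fixes F :: "real^2 \<Rightarrow> real"
  assumes "continuous_on (cbox 0 1) F"
  shows "integral (cbox 0 1) F = integral {0..1} (\<lambda>s. integral {0..1} (\<lambda>t. F (vector [s, t])))"
proof -
  define f where "f = (\<lambda>(s, t). F (vector [s, t]))"
  have v: "(vector [s, t] :: real^2) $ 1 = s" "(vector [s, t] :: real^2) $ 2 = t" for s t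
    by simp_all
  have vc: "continuous_on S (\<lambda>q. vector [a q, b q] :: real^2)"
    if "continuous_on S a" "continuous_on S b" for S and a b :: "'z::t2_space \<Rightarrow> real"
  proof -
    have "(\<lambda>q. vector [a q, b q] :: real^2) = (\<lambda>q. \<chi> i. if i = 1 then a q else b q)"
      by (auto simp: vec_eq_iff forall_2 fun_eq_iff)
    then show ?thesis
      using that by (simp only:) (intro continuous_on_vec_lambda, case_tac "i = 1", simp_all)
  qed
  have fc: "continuous_on (cbox (0, 0) (1, 1)) f"
    unfolding f_def split_beta
    by (rule continuous_on_compose2[OF assms]) (auto intro!: vc continuous_intros simp: mem_box_cart forall_2)
  have f: "(f has_integral integral (cbox (0, 0) (1, 1)) f) (cbox (0, 0) (1, 1))"
    by (intro integrable_integral integrable_continuous fc)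
  have fub: "integral (cbox (0, 0) (1, 1)) f = integral {0..1} (\<lambda>s. integral {0..1} (\<lambda>t. F (vector [s, t])))"
    using integral_prod_continuous[OF fc] by (simp add: f_def)
  have img1: "(\<lambda>z::real^2. (z $ 1, z $ 2)) ` cbox u v = cbox (u $ 1, u $ 2) (v $ 1, v $ 2)" for u v
    by (auto simp: mem_box_cart forall_2 image_iff intro!: bexI[of _ "vector [_, _]"])
  have img2: "(\<lambda>(s, t). vector [s, t] :: real^2) ` cbox u v = cbox (vector [fst u, snd u]) (vector [fst v, snd v])" for u v
    by (cases u; cases v) (force simp: mem_box_cart forall_2 image_iff vec_eq_iff)
  have "((\<lambda>z. f (z $ 1, z $ 2)) has_integral (1 / 1) *\<^sub>R integral (cbox (0, 0) (1, 1)) f)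
      ((\<lambda>(s, t). vector [s, t] :: real^2) ` cbox (0, 0) (1, 1))"
  proof (rule has_integral_twiddle[OF _ _ _ _ _ _ _ f])
    show "measure lborel ((\<lambda>z::real^2. (z $ 1, z $ 2)) ` cbox u v) = 1 * measure lborel (cbox u v)" for u v
    proof -
      have ex2: "(\<exists>i::2. Q i) \<longleftrightarrow> Q 1 \<or> Q 2" for Q
        using forall_2[of "\<lambda>i. \<not> Q i"] by blast
      show ?thesis
        unfolding img1 content_Pair
        by (simp add: content_cbox_if_cart interval_eq_empty_cart ex2 UNIV_2 content_real_if)
    qed
    show "\<exists>w z. (\<lambda>z::real^2. (z $ 1, z $ 2)) ` cbox u v = cbox w z" for u v
      unfolding img1 by blast
    show "\<exists>w z. (\<lambda>(s, t). vector [s, t] :: real^2) ` cbox u v = cbox w z" for u v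
      unfolding img2 by blast
  qed (auto simp: vec_eq_iff forall_2 intro!: continuous_intros)
  moreover have "(vector [0, 0] :: real^2) = 0" "(vector [1, 1] :: real^2) = 1"
    "f (z $ 1, z $ 2) = F z" for z
    by (auto simp: f_def vec_eq_iff forall_2 intro!: arg_cong[of _ _ F])
  ultimately show ?thesis
    by (simp add: img2 fub has_integral_iff)
qed

lemma vec2_expand: "(v :: real^2) = v $ 1 *\<^sub>R axis 1 1 + v $ 2 *\<^sub>R axis 2 1"
  by (simp add: vec_eq_iff forall_2 axis_def)

lemma has_derivative_partials_2:
  fixes f :: "real^2 \<Rightarrow> 'a::real_normed_vector"
  assumes "f differentiable at p"
  shows "(f has_derivative (\<lambda>v. v $ 1 *\<^sub>R frechet_derivative f (at p) (axis 1 1)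
    + v $ 2 *\<^sub>R frechet_derivative f (at p) (axis 2 1))) (at p)"
proof -
  have d: "(f has_derivative frechet_derivative f (at p)) (at p)"
    using assms frechet_derivative_works by blast
  then interpret linear "frechet_derivative f (at p)"
    by (rule has_derivative_linear)
  have "frechet_derivative f (at p) = (\<lambda>v. v $ 1 *\<^sub>R frechet_derivative f (at p) (axis 1 1)
    + v $ 2 *\<^sub>R frechet_derivative f (at p) (axis 2 1))"
  proof
    fix v
    show "frechet_derivative f (at p) v = v $ 1 *\<^sub>R frechet_derivative f (at p) (axis 1 1)
      + v $ 2 *\<^sub>R frechet_derivative f (at p) (axis 2 1)"
      by (subst (1) vec2_expand) (simp add: add scale)
  qed
  with d show ?thesis by metis
qed

text \<open>\<open>boost x\<close> carries the base point to \<open>x\<close>, so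
  \<open>gram_tangent\<close> exhibits the Gram determinant as half of a squared norm.\<close>

lemma gram_nonneg:
  fixes x :: "real^('n::finite option)"
  assumes "x \<in> hyperbolic_space" "minkowski x u = 0" "minkowski x v = 0"
  shows "gram u v \<ge> 0"
proof -
  have "boost x *v axis None 1 = x"
    using proj_boost[of x] by (simp add: proj_def)
  from gram_tangent[OF boost_O1n[OF assms(1)] this assms(2,3)] show ?thesis
    by (simp only: lie_inner_self) simp
qed

text \<open>The boundary circle starts at \<open>p0\<close> in the direction \<open>q0\<close>; the circles through \<open>p0\<close> obtained
  from it by homotheties centred at \<open>p0\<close> sweep out the disk.\<close>

locale based_disk =
  fixes \<phi> :: "real^2 \<Rightarrow> real^('n::finite option)" and U :: "(real^2) set" and p0 q0 :: "real^2"
  assumes U: "open U" "cball 0 1 \<subseteq> U" and smooth: "smooth_on \<phi> U"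
    and hyp: "\<phi> ` cball 0 1 \<subseteq> hyperbolic_space"
    and frame: "norm p0 = 1" "norm q0 = 1" "p0 \<bullet> q0 = 0"
    and base_point: "\<phi> p0 = axis None 1"
begin

definition "circle t = cos (2 * pi * t) *\<^sub>R p0 + sin (2 * pi * t) *\<^sub>R q0"
definition "circle' t = (2 * pi) *\<^sub>R (cos (2 * pi * t) *\<^sub>R q0 - sin (2 * pi * t) *\<^sub>R p0)"
definition "sweep s t = p0 + s *\<^sub>R (circle t - p0)"
definition "D i p = frechet_derivative \<phi> (at p) (axis i 1)"
definition "DD i j p = frechet_derivative (D i) (at p) (axis j 1)"
definition "area_density p = sqrt (gram (D 1 p) (D 2 p))"

lemma
  shows deriv_\<phi>: "p \<in> U \<Longrightarrow> (\<phi> has_derivative (\<lambda>v. v $ 1 *\<^sub>R D 1 p + v $ 2 *\<^sub>R D 2 p)) (at p)"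
    and deriv_D: "p \<in> U \<Longrightarrow> (D i has_derivative (\<lambda>v. v $ 1 *\<^sub>R DD i 1 p + v $ 2 *\<^sub>R DD i 2 p)) (at p)"
    and cont_\<phi>: "continuous_on U \<phi>" and cont_D: "continuous_on U (D i)"
    and cont_DD: "continuous_on U (DD i j)"
proof -
  have C2: "Ck_on (Suc (Suc 0)) \<phi> U"
    using smooth unfolding smooth_on_def by blast
  then have d\<phi>: "\<phi> differentiable at p" and dD: "D i differentiable at p" if "p \<in> U" for p i
    using that by (auto simp: D_def[abs_def])
  show "continuous_on U (DD i j)"
    using C2 by (auto simp: DD_def[abs_def] D_def[abs_def])
  show "p \<in> U \<Longrightarrow> (\<phi> has_derivative (\<lambda>v. v $ 1 *\<^sub>R D 1 p + v $ 2 *\<^sub>R D 2 p)) (at p)"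
    unfolding D_def by (rule has_derivative_partials_2[OF d\<phi>])
  show "p \<in> U \<Longrightarrow> (D i has_derivative (\<lambda>v. v $ 1 *\<^sub>R DD i 1 p + v $ 2 *\<^sub>R DD i 2 p)) (at p)"
    unfolding DD_def by (rule has_derivative_partials_2[OF dD])
  show "continuous_on U \<phi>" "continuous_on U (D i)"
    using d\<phi> dD by (auto intro!: continuous_at_imp_continuous_on differentiable_imp_continuous_within)
qed

lemma frame_inner [simp]: "p0 \<bullet> p0 = 1" "q0 \<bullet> q0 = 1" "p0 \<bullet> q0 = 0" "q0 \<bullet> p0 = 0"
  using frame by (simp_all add: dot_square_norm inner_commute)

lemma norm_circle: "norm (circle t) = 1"
proof -
  have "circle t \<bullet> circle t = 1"
    by (simp add: circle_def inner_add_left inner_add_right flip: power2_eq_square)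
  then show ?thesis by (simp add: norm_eq_1)
qed

lemma hyperbolic_disk:
  assumes "p \<in> cball 0 1"
  shows "\<phi> p \<in> hyperbolic_space" "minkowski (\<phi> p) (\<phi> p) = -1"
proof -
  show "\<phi> p \<in> hyperbolic_space" using hyp assms by blast
  then show "minkowski (\<phi> p) (\<phi> p) = -1" by (simp add: hyperbolic_space_def)
qed

lemma sweep_in_disk: "s \<in> {0..1} \<Longrightarrow> sweep s t \<in> cball 0 1"
proof -
  assume "s \<in> {0..1}"
  then have "(1 - s) *\<^sub>R p0 + s *\<^sub>R circle t \<in> cball 0 1"
    using frame(1) norm_circle by (intro convexD_alt[OF convex_cball]) auto
  then show ?thesis by (simp add: sweep_def algebra_simps)
qed

lemma sweep_in_U: "s \<in> {0..1} \<Longrightarrow> sweep s t \<in> U"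
  using sweep_in_disk U(2) by blast

lemma circle_deriv: "(circle has_vector_derivative circle' t) (at t within S)"
  unfolding circle_def[abs_def] circle'_def has_vector_derivative_def
  by (auto intro!: derivative_eq_intros simp: algebra_simps)

lemma cont_circle: "continuous_on S (\<lambda>q. circle (a q))" "continuous_on S (\<lambda>q. circle' (a q))"
  if "continuous_on S a" for S and a :: "'z::t2_space \<Rightarrow> real"
  unfolding circle_def circle'_def using that by (auto intro!: continuous_intros)

lemma cont_sweep: "continuous_on S (\<lambda>q. sweep (a q) (b q))"
  if "continuous_on S a" "continuous_on S b" for S and a b :: "'z::t2_space \<Rightarrow> real"
  unfolding sweep_def using that by (auto intro!: continuous_intros cont_circle)

lemma sweep_deriv_s: "((\<lambda>s. sweep s t) has_vector_derivative circle t - p0) (at s within S)"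
  unfolding sweep_def has_vector_derivative_def by (auto intro!: derivative_eq_intros)

lemma sweep_deriv_t: "((\<lambda>t. sweep s t) has_vector_derivative s *\<^sub>R circle' t) (at t within S)"
proof -
  have "((\<lambda>t. p0 + s *\<^sub>R (circle t - p0)) has_vector_derivative 0 + s *\<^sub>R (circle' t - 0)) (at t within S)"
    by (intro has_vector_derivative_add has_vector_derivative_const
        bounded_linear.has_vector_derivative[OF bounded_linear_scaleR_right]
        has_vector_derivative_diff circle_deriv)
  then show ?thesis by (simp add: sweep_def)
qed

lemma chain:
  assumes "(c has_vector_derivative v) (at t within S)" "c t \<in> U"
  shows "((\<lambda>t. \<phi> (c t)) has_vector_derivative v $ 1 *\<^sub>R D 1 (c t) + v $ 2 *\<^sub>R D 2 (c t)) (at t within S)"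
    "((\<lambda>t. D i (c t)) has_vector_derivative v $ 1 *\<^sub>R DD i 1 (c t) + v $ 2 *\<^sub>R DD i 2 (c t)) (at t within S)"
  using vector_derivative_diff_chain_within[OF assms(1) has_derivative_at_withinI[OF deriv_\<phi>[OF assms(2)]]]
    vector_derivative_diff_chain_within[OF assms(1) has_derivative_at_withinI[OF deriv_D[OF assms(2)]]]
  by (simp_all add: o_def)

definition "xs s t = (circle t - p0) $ 1 *\<^sub>R D 1 (sweep s t) + (circle t - p0) $ 2 *\<^sub>R D 2 (sweep s t)"
definition "xt s t = (s *\<^sub>R circle' t) $ 1 *\<^sub>R D 1 (sweep s t) + (s *\<^sub>R circle' t) $ 2 *\<^sub>R D 2 (sweep s t)"
definition "Ds i s t = (circle t - p0) $ 1 *\<^sub>R DD i 1 (sweep s t) + (circle t - p0) $ 2 *\<^sub>R DD i 2 (sweep s t)"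
definition "xst s t = circle' t $ 1 *\<^sub>R (D 1 (sweep s t) + s *\<^sub>R Ds 1 s t)
  + circle' t $ 2 *\<^sub>R (D 2 (sweep s t) + s *\<^sub>R Ds 2 s t)"

lemma cont_comp: "continuous_on ({0..1} \<times> {0..1}) (\<lambda>q. \<psi> (sweep (fst q) (snd q)))"
  if "continuous_on U \<psi>" for \<psi> :: "real^2 \<Rightarrow> 'z::topological_space"
  by (rule continuous_on_compose2[OF that])
    (use sweep_in_U in \<open>auto intro!: cont_sweep continuous_on_fst continuous_on_snd continuous_on_id\<close>)

sublocale loop_family "\<lambda>s t. \<phi> (sweep s t)" xs xt xst
proof
  note [continuous_intros] = cont_comp[OF cont_\<phi>] cont_comp[OF cont_D] cont_comp[OF cont_DD] cont_circle
  show "continuous_on ({0..1} \<times> {0..1}) (\<lambda>(s, t). \<phi> (sweep s t))"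
    "continuous_on ({0..1} \<times> {0..1}) (\<lambda>(s, t). xs s t)"
    "continuous_on ({0..1} \<times> {0..1}) (\<lambda>(s, t). xt s t)"
    "continuous_on ({0..1} \<times> {0..1}) (\<lambda>(s, t). xst s t)"
    unfolding xs_def xt_def xst_def Ds_def split_beta by (intro continuous_intros)+
  fix s t :: real assume st: "s \<in> {0..1}" "t \<in> {0..1}"
  note p = sweep_in_U[OF st(1), of t]
  show "((\<lambda>t. \<phi> (sweep s t)) has_vector_derivative xt s t) (at t within {0..1})"
    unfolding xt_def by (rule chain(1)[OF sweep_deriv_t p])
  show "((\<lambda>s. \<phi> (sweep s t)) has_vector_derivative xs s t) (at s within {0..1})"
    unfolding xs_def by (rule chain(1)[OF sweep_deriv_s p])
  show "((\<lambda>s. xt s t) has_vector_derivative xst s t) (at s within {0..1})"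
  proof -
    have Ds: "((\<lambda>s. s *\<^sub>R D i (sweep s t)) has_vector_derivative D i (sweep s t) + s *\<^sub>R Ds i s t) (at s within {0..1})" for i
      using has_vector_derivative_scaleR[OF DERIV_ident chain(2)[OF sweep_deriv_s p, of i]]
      by (simp add: Ds_def add.commute)
    have "((\<lambda>s. circle' t $ 1 *\<^sub>R (s *\<^sub>R D 1 (sweep s t)) + circle' t $ 2 *\<^sub>R (s *\<^sub>R D 2 (sweep s t)))
        has_vector_derivative xst s t) (at s within {0..1})"
      unfolding xst_def
      by (intro has_vector_derivative_add bounded_linear.has_vector_derivative[OF bounded_linear_scaleR_right] Ds)
    then show ?thesis
      by (simp add: xt_def mult.commute)
  qed
  show "minkowski (\<phi> (sweep s t)) (\<phi> (sweep s t)) = -1"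
    by (rule hyperbolic_disk(2)[OF sweep_in_disk[OF st(1)]])
next
  fix s t :: real
  show "\<phi> (sweep s 0) = axis None 1" "\<phi> (sweep s 1) = axis None 1" "\<phi> (sweep 0 t) = axis None 1"
    by (simp_all add: sweep_def circle_def base_point)
qed

text \<open>The extension of \<open>\<phi>\<close> beyond the closed disk may leave the hyperboloid,
  so tangency of the partial derivatives is obtained by differentiation in the open disk only.
  Nonnegativity then passes to the boundary by continuity.\<close>

lemma gram_nonneg_disk:
  assumes "p \<in> cball 0 1"
  shows "gram (D 1 p) (D 2 p) \<ge> 0"
proof (rule continuous_ge_on_closure[of "ball 0 1" "\<lambda>p. gram (D 1 p) (D 2 p)"])
  have "continuous_on (cball 0 1) (D i)" for i
    using continuous_on_subset[OF cont_D U(2)] .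
  then show "continuous_on (closure (ball 0 1)) (\<lambda>p. gram (D 1 p) (D 2 p))"
    unfolding gram_def by (auto intro!: continuous_intros)
  show "p \<in> closure (ball 0 1)" using assms by simp
  fix p :: "real^2" assume p: "p \<in> ball 0 1"
  then have pU: "p \<in> U" using U(2) by auto
  have "minkowski (\<phi> p) (D i p) = 0" for i
  proof -
    have "((\<lambda>p. minkowski (\<phi> p) (\<phi> p)) has_derivative (\<lambda>v. minkowski (\<phi> p) (v $ 1 *\<^sub>R D 1 p + v $ 2 *\<^sub>R D 2 p)
        + minkowski (v $ 1 *\<^sub>R D 1 p + v $ 2 *\<^sub>R D 2 p) (\<phi> p))) (at p)"
      by (rule minkowski.FDERIV[OF deriv_\<phi>[OF pU] deriv_\<phi>[OF pU]])
    moreover have "((\<lambda>p. minkowski (\<phi> p) (\<phi> p)) has_derivative (\<lambda>v. 0)) (at p)"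
    proof (rule has_derivative_transform_within_open[OF has_derivative_const open_ball p])
      show "-1 = minkowski (\<phi> p) (\<phi> p)" if "p \<in> ball 0 1" for p
        using hyperbolic_disk(2)[of p] that by simp
    qed
    ultimately have "(\<lambda>v::real^2. minkowski (\<phi> p) (v $ 1 *\<^sub>R D 1 p + v $ 2 *\<^sub>R D 2 p)
        + minkowski (v $ 1 *\<^sub>R D 1 p + v $ 2 *\<^sub>R D 2 p) (\<phi> p)) = (\<lambda>v. 0)"
      by (rule has_derivative_unique)
    from fun_cong[OF this, of "axis i 1"] show ?thesis
      using exhaust_2[of i] by (auto simp: axis_def minkowski_commute[of _ "\<phi> p"])
  qed
  then show "0 \<le> gram (D 1 p) (D 2 p)"
    using hyperbolic_disk(1)[of p] p by (intro gram_nonneg[of "\<phi> p"]) auto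
qed

lemma area_density_nonneg: "p \<in> cball 0 1 \<Longrightarrow> area_density p \<ge> 0"
  using gram_nonneg_disk by (simp add: area_density_def)

lemma cont_area_density: "continuous_on (cball 0 1) area_density"
  unfolding area_density_def gram_def
  by (intro continuous_intros continuous_on_subset[OF cont_D U(2)])

lemma area_density_integrable: "area_density integrable_on cball 0 1"
  using borel_integrable_compact[OF compact_cball cont_area_density]
  by (intro set_borel_integral_eq_integral(1)) (simp add: set_integrable_def)

lemma disk_area_eq: "disk_area \<phi> = integral (cball 0 1) area_density"
  by (simp add: disk_area_def area_density_def[abs_def] gram_def D_def Let_def)

section \<open>The area swept out by the tangent circles\<close>

definition "jac s t = (circle t - p0) $ 1 * (s *\<^sub>R circle' t) $ 2 - (circle t - p0) $ 2 * (s *\<^sub>R circle' t) $ 1"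

lemma sqrt_gram_sweep: "sqrt (gram (xs s t) (xt s t)) = \<bar>jac s t\<bar> * area_density (sweep s t)"
  unfolding xs_def xt_def gram_linear area_density_def jac_def by (simp add: real_sqrt_mult)

text \<open>The vector \<open>w = s *\<^sub>R (circle t - p0)\<close> satisfies
  \<open>w \<bullet> w = - 2 * s * (w \<bullet> p0)\<close>, and \<open>w \<bullet> p0\<close> is
  negative for \<open>t\<close> strictly between 0 and 1. So \<open>w\<close> determines
  \<open>s\<close>, and then sine and cosine determine \<open>t\<close>.\<close>

lemma sweep_inj:
  assumes s: "s > 0" "s' > 0" and t: "t \<in> {0<..<1}" "t' \<in> {0<..<1}"
    and eq: "sweep s t = sweep s' t'"
  shows "s = s'" "t = t'"
proof -
  define C S where "C t = cos (2 * pi * t)" and "S t = sin (2 * pi * t)" for t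
  have C2: "C t * C t + S t * S t = 1" for t
    unfolding C_def S_def using sin_cos_squared_add3 by blast
  have C1: "C t < 1" if "t \<in> {0<..<1}" for t
  proof -
    have "C t \<noteq> 1"
    proof
      assume "C t = 1"
      then obtain n :: int where "2 * pi * t = real_of_int n * 2 * pi"
        unfolding C_def cos_one_2pi_int by blast
      then have "t = real_of_int n" by simp
      with that have "0 < n" "n < 1" by simp_all
      then show False by linarith
    qed
    then show ?thesis
      using cos_le_one[of "2 * pi * t"] unfolding C_def by linarith
  qed
  have "s *\<^sub>R (circle t - p0) = s' *\<^sub>R (circle t' - p0)"
    using eq by (simp add: sweep_def)
  from arg_cong[OF this, of "\<lambda>v. v \<bullet> p0"] arg_cong[OF this, of "\<lambda>v. v \<bullet> q0"]
  have 1: "s * (C t - 1) = s' * (C t' - 1)" and 2: "s * S t = s' * S t'"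
    by (simp_all add: circle_def C_def S_def inner_add_left inner_diff_left)
  have sq: "(s * (C t - 1))\<^sup>2 + (s * S t)\<^sup>2 = - 2 * s * (s * (C t - 1))" for s t
  proof -
    have "(s * (C t - 1))\<^sup>2 + (s * S t)\<^sup>2 = s * s * ((C t * C t + S t * S t) - 2 * C t + 1)"
      by (simp add: power2_eq_square algebra_simps)
    then show ?thesis by (simp add: C2 algebra_simps)
  qed
  have "s * (s' * (C t' - 1)) = s' * (s' * (C t' - 1))"
    using sq[of s t] sq[of s' t'] unfolding 1 2 by linarith
  then show ss: "s = s'"
    using s(2) C1[OF t(2)] by simp
  then have "cos (2 * pi * t) = cos (2 * pi * t')" "sin (2 * pi * t) = sin (2 * pi * t')"
    using 1 2 s by (simp_all add: C_def S_def)
  then obtain n :: int where "2 * pi * t = 2 * pi * t' + 2 * pi * of_int n"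
    using sin_cos_eq_iff by blast
  then have "2 * pi * (t - t' - of_int n) = 0" by (simp add: algebra_simps)
  then have n: "t - t' = of_int n" by simp
  moreover have "\<bar>t - t'\<bar> < 1" using t by auto
  ultimately have "n = 0" by linarith
  with n show "t = t'" by simp
qed

text \<open>The sweep maps the open square injectively into the disk. As the density is nonnegative,
  its integral over the image is at most the area, and the image itself never has to be
  computed.\<close>

lemma area_sweep_le:
  "integral {0..1} (\<lambda>s. integral {0..1} (\<lambda>t. \<bar>jac s t\<bar> * area_density (sweep s t))) \<le> disk_area \<phi>"
proof -
  define T where "T z = sweep (z $ 1) (z $ 2)" for z :: "real^2"
  define T' where "T' z v = v $ 1 *\<^sub>R (circle (z $ 2) - p0) + v $ 2 *\<^sub>R ((z $ 1) *\<^sub>R circle' (z $ 2))" for z v :: "real^2"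
  define F where "F z = \<bar>jac (z $ 1) (z $ 2)\<bar> * area_density (T z)" for z
  have T_deriv: "(T has_derivative T' z) (at z within S)" for z S
  proof -
    have c: "((\<lambda>z::real^2. circle (z $ 2)) has_derivative (\<lambda>v. v $ 2 *\<^sub>R circle' (z $ 2))) (at z within S)"
      using has_derivative_compose[OF bounded_linear_imp_has_derivative[OF bounded_linear_vec_nth]
          circle_deriv[of "z $ 2" UNIV, unfolded has_vector_derivative_def]] by simp
    show ?thesis
      unfolding T_def[abs_def] T'_def sweep_def
      by (auto intro!: derivative_eq_intros c bounded_linear_imp_has_derivative bounded_linear_vec_nth
          simp: algebra_simps)
  qed
  have det: "det (matrix (T' z)) = jac (z $ 1) (z $ 2)" for z
    by (simp add: det_2 matrix_def T'_def axis_def jac_def)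
  have Tdisk: "T z \<in> cball 0 1" if "z \<in> cbox 0 1" for z
    unfolding T_def by (rule sweep_in_disk) (use that in \<open>auto simp: mem_box_cart\<close>)
  have contT: "continuous_on S T" for S
    unfolding T_def by (intro cont_sweep continuous_intros)
  have contF: "continuous_on (cbox 0 1) F"
    unfolding F_def jac_def
    by (intro continuous_intros cont_circle continuous_on_compose2[OF cont_area_density contT])
      (use Tdisk in auto)
  \<comment> \<open>On the closed square injectivity fails: the sides \<open>s = 0\<close>,
    \<open>t = 0\<close> and \<open>t = 1\<close> all collapse to \<open>p0\<close>. Dropping the
    boundary does not change the integral.\<close>
  have inj: "inj_on T (box 0 1)"
  proof (rule inj_onI)
    fix z w :: "real^2" assume "z \<in> box 0 1" "w \<in> box 0 1" "T z = T w"
    then show "z = w"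
      using sweep_inj[of "z $ 1" "w $ 1" "z $ 2" "w $ 2"]
      by (auto simp: mem_box_cart forall_2 T_def vec_eq_iff)
  qed
  \<comment> \<open>The change of variables theorem speaks of functions with values in
    \<open>real^m\<close>, hence the detour through one-dimensional vectors.\<close>
  let ?v = "\<lambda>a. vec a :: real^1"
  have "continuous_on (cbox 0 1) (\<lambda>z. ?v (F z))"
    using contF by (auto simp: vec_def intro!: continuous_on_vec_lambda)
  then have "(\<lambda>z. ?v (F z)) absolutely_integrable_on cbox 0 1"
    by (rule absolutely_integrable_continuous)
  then have "(\<lambda>z. ?v (F z)) absolutely_integrable_on box 0 1"
    by (rule set_integrable_subset) (auto simp: box_subset_cbox)
  moreover have Feq: "?v (F z) = \<bar>det (matrix (T' z))\<bar> *\<^sub>R ?v (area_density (T z))" for z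
    by (simp add: F_def det vec_eq_iff)
  ultimately have "(\<lambda>p. ?v (area_density p)) absolutely_integrable_on (T ` box 0 1) \<and>
    integral (T ` box 0 1) (\<lambda>p. ?v (area_density p)) = integral (box 0 1) (\<lambda>z. ?v (F z))"
    by (subst has_absolute_integral_change_of_variables[OF _ T_deriv inj, symmetric]) auto
  then have "((\<lambda>p. ?v (area_density p)) has_integral integral (box 0 1) (\<lambda>z. ?v (F z))) (T ` box 0 1)"
    using set_lebesgue_integral_eq_integral(1) has_integral_iff by blast
  from has_integral_linear[OF this bounded_linear_vec_nth[of 1]]
  have dens: "(area_density has_integral integral (box 0 1) (\<lambda>z. ?v (F z)) $ 1) (T ` box 0 1)"
    by (simp add: o_def)
  have "((\<lambda>z. ?v (F z)) has_integral integral (box 0 1) (\<lambda>z. ?v (F z))) (box 0 1)"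
    using \<open>(\<lambda>z. ?v (F z)) absolutely_integrable_on box 0 1\<close> set_lebesgue_integral_eq_integral(1) by blast
  from has_integral_linear[OF this bounded_linear_vec_nth[of 1]]
  have "integral (box 0 1) F = integral (box 0 1) (\<lambda>z. ?v (F z)) $ 1"
    by (simp add: o_def has_integral_iff)
  with dens have dens': "(area_density has_integral integral (cbox 0 1) F) (T ` box 0 1)"
    by (simp add: integral_open_interval)
  have "integral {0..1} (\<lambda>s. integral {0..1} (\<lambda>t. \<bar>jac s t\<bar> * area_density (sweep s t))) = integral (cbox 0 1) F"
    unfolding integral_cart_2[OF contF] by (simp add: F_def T_def)
  also have "\<dots> = integral (T ` box 0 1) area_density"
    using dens' by (simp add: has_integral_iff)
  also have "\<dots> \<le> integral (cball 0 1) area_density"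
  proof (rule integral_subset_le)
    show "T ` box 0 1 \<subseteq> cball 0 1"
      using Tdisk box_subset_cbox by blast
    show "area_density integrable_on T ` box 0 1"
      using dens' by blast
  qed (use area_density_nonneg area_density_integrable in auto)
  finally show ?thesis
    by (simp add: disk_area_eq)
qed

lemma disk_area_nonneg: "disk_area \<phi> \<ge> 0"
  unfolding disk_area_eq
  by (intro integral_nonneg area_density_integrable area_density_nonneg)

text \<open>By \<open>sqrt_gram_sweep\<close> the bound on \<open>K\<close> integrates to the area
  swept out by the loops, counted with the Jacobian, so the holonomy curve is short enough to be
  lengthened to \<open>disk_area \<phi>\<close>.\<close>

lemma holonomy_curve:
  assumes "CARD('n) \<ge> 2"
  obtains G f where "G 0 = mat 1"
    "\<And>t. t \<in> {0..1} \<Longrightarrow> (G has_vector_derivative minkowski_wedge (\<phi> (circle t))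
      (circle' t $ 1 *\<^sub>R D 1 (circle t) + circle' t $ 2 *\<^sub>R D 2 (circle t)) ** G t) (at t within {0..1})"
    "C1_curve f" "\<And>t. t \<in> {0..1} \<Longrightarrow> f t \<in> SOn" "f 0 = mat 1" "f 1 = G 1"
    "curve_length f = disk_area \<phi>"
proof -
  obtain g h K where g: "\<And>s. g s 0 = mat 1"
    "\<And>s t. s \<in> {0..1} \<Longrightarrow> t \<in> {0..1} \<Longrightarrow>
      (g s has_vector_derivative minkowski_wedge (\<phi> (sweep s t)) (xt s t) ** g s t) (at t within {0..1})"
    and h: "\<And>s. h s = g s 1" "h 0 = mat 1" "\<And>s. s \<in> {0..1} \<Longrightarrow> h s \<in> SOn"
    "continuous_on {0..1} K"
    "\<And>s. s \<in> {0..1} \<Longrightarrow> (h has_vector_derivative h s ** K s) (at s within {0..1})"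
    "\<And>s. s \<in> {0..1} \<Longrightarrow> norm (K s) \<le> sqrt 2 * integral {0..1} (\<lambda>t. sqrt (gram (xs s t) (xt s t)))"
    using transport_exists by blast
  let ?I = "\<lambda>s. integral {0..1} (\<lambda>t. \<bar>jac s t\<bar> * area_density (sweep s t))"
  have "continuous_on ({0..1} \<times> {0..1}) (\<lambda>q. \<bar>jac (fst q) (snd q)\<bar> * area_density (sweep (fst q) (snd q)))"
    unfolding jac_def
    by (intro continuous_intros cont_circle continuous_on_compose2[OF cont_area_density cont_sweep])
      (use sweep_in_disk in auto)
  then have "continuous_on {0..1} ?I"
    using integral_continuous_on_param[of "{0..1}" 0 1 "\<lambda>s t. \<bar>jac s t\<bar> * area_density (sweep s t)"]
    by (simp add: split_beta)
  then have "integral {0..1} (\<lambda>s. norm (K s)) \<le> integral {0..1} (\<lambda>s. sqrt 2 * ?I s)"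
    using h(6) by (intro integral_le integrable_continuous_real continuous_intros h(4))
      (auto simp: sqrt_gram_sweep)
  then have "integral {0..1} (\<lambda>s. norm (K s)) / sqrt 2 \<le> integral {0..1} ?I"
    by (simp add: divide_le_eq mult.commute)
  also note area_sweep_le
  finally have len: "integral {0..1} (\<lambda>s. norm (K s)) / sqrt 2 \<le> disk_area \<phi>" .
  obtain f where f: "C1_curve f" "\<And>t. t \<in> {0..1} \<Longrightarrow> f t \<in> SOn" "f 0 = mat 1" "f 1 = h 1"
    "curve_length f = disk_area \<phi>"
    by (rule lengthen_curve[OF assms h(3,2,5,4) len]) blast+
  \<comment> \<open>The last loop of the sweep, at \<open>s = 1\<close>, is the boundary circle
    itself.\<close>
  show ?thesis
    using that[of "g 1" f] g(1) g(2)[of 1] f h(1) by (simp add: xt_def sweep_def)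
qed

end

section \<open>The boundary curve\<close>

text \<open>A continuous logarithm provides the angle. Since the curve avoids its starting point at
  interior times, the angle in full turns takes no integer value there, and the intermediate value
  theorem confines it to the unit interval. The vector \<open>q\<close> absorbs the direction of
  travel.\<close>

lemma simple_circle_lift:
  fixes \<beta> :: "real \<Rightarrow> real^2"
  assumes cont: "continuous_on {0..1} \<beta>" and unit: "\<And>t. t \<in> {0..1} \<Longrightarrow> norm (\<beta> t) = 1"
    and simple: "\<And>t. t \<in> {0<..<1} \<Longrightarrow> \<beta> t \<noteq> \<beta> 0" and closed: "\<beta> 1 = \<beta> 0"
  obtains q \<theta> where "norm q = 1" "\<beta> 0 \<bullet> q = 0" "continuous_on {0..1} \<theta>" "\<theta> ` {0..1} \<subseteq> {0..1}"
    "\<theta> 0 = 0" "\<theta> 1 = 0 \<or> \<theta> 1 = 1"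
    "\<And>t. t \<in> {0..1} \<Longrightarrow> \<beta> t = cos (2 * pi * \<theta> t) *\<^sub>R \<beta> 0 + sin (2 * pi * \<theta> t) *\<^sub>R q"
proof -
  define p r :: "real^2" where "p = \<beta> 0" and "r = vector [- (p $ 2), p $ 1]"
  have pp: "p $ 1 * p $ 1 + p $ 2 * p $ 2 = 1"
    using unit[of 0] by (simp add: p_def norm_eq_1 inner_vec_def sum_2)
  have r: "norm r = 1" "p \<bullet> r = 0"
    using pp by (simp_all add: r_def norm_eq_1 inner_vec_def sum_2 algebra_simps)
  have expand: "v = (v \<bullet> p) *\<^sub>R p + (v \<bullet> r) *\<^sub>R r" for v
  proof -
    have "(v \<bullet> p) * p $ 1 + (v \<bullet> r) * r $ 1 = v $ 1 * (p $ 1 * p $ 1 + p $ 2 * p $ 2)"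
      "(v \<bullet> p) * p $ 2 + (v \<bullet> r) * r $ 2 = v $ 2 * (p $ 1 * p $ 1 + p $ 2 * p $ 2)"
      by (simp_all add: r_def inner_vec_def sum_2 algebra_simps)
    then show ?thesis
      by (simp add: vec_eq_iff forall_2 pp)
  qed
  define z where "z t = Complex (\<beta> t \<bullet> p) (\<beta> t \<bullet> r)" for t
  have norm_z: "norm (z t) = 1" if "t \<in> {0..1}" for t
  proof -
    have "\<beta> t \<bullet> \<beta> t = (\<beta> t \<bullet> p) * (\<beta> t \<bullet> p) + (\<beta> t \<bullet> r) * (\<beta> t \<bullet> r)"
      by (subst (2) expand) (simp add: inner_add_right)
    then have "(\<beta> t \<bullet> p)\<^sup>2 + (\<beta> t \<bullet> r)\<^sup>2 = 1"
      using unit[OF that] by (simp add: norm_eq_1 power2_eq_square)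
    then show ?thesis
      by (simp add: z_def cmod_def)
  qed
  have "continuous_on {0..1} z"
    unfolding z_def Complex_eq by (intro continuous_intros cont)
  moreover have "contractible {0..1::real}"
    by (simp add: convex_imp_contractible)
  moreover have "z t \<noteq> 0" if "t \<in> {0..1}" for t
    using norm_z[OF that] by auto
  ultimately obtain w where w: "continuous_on {0..1} w" "\<And>t. t \<in> {0..1} \<Longrightarrow> z t = exp (w t)"
    by (rule continuous_logarithm_on_contractible) auto
  define a where "a t = (Im (w t) - Im (w 0)) / (2 * pi)" for t
  have a_cont: "continuous_on {0..1} a"
    unfolding a_def by (intro continuous_intros w(1)) auto
  have a0: "a 0 = 0" by (simp add: a_def)
  have zw: "z t = cis (Im (w t))" if "t \<in> {0..1}" for t
  proof -
    have "exp (Re (w t)) = 1"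
      using norm_z[OF that] w(2)[OF that] by simp
    then show ?thesis
      by (simp add: w(2)[OF that] exp_eq_polar)
  qed
  have "z 0 = 1"
    using pp r(2) by (simp add: z_def p_def[symmetric] complex_eq_iff inner_vec_def sum_2)
  then have "cis (Im (w 0)) = 1"
    using zw[of 0] by simp
  then have za: "z t = cis (2 * pi * a t)" if "t \<in> {0..1}" for t
    using zw[OF that] by (simp add: a_def cis_divide[symmetric])
  have \<beta>a: "\<beta> t = cos (2 * pi * a t) *\<^sub>R p + sin (2 * pi * a t) *\<^sub>R r" if "t \<in> {0..1}" for t
    using expand[of "\<beta> t"] za[OF that] by (simp add: z_def complex_eq_iff)
  \<comment> \<open>The sign makes the angle positive at the midpoint; replacing \<open>r\<close> by
    \<open>\<sigma> *\<^sub>R r\<close> compensates for it in the formula for the curve.\<close>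
  define \<sigma> :: real where "\<sigma> = (if a (1/2) > 0 then 1 else -1)"
  define \<theta> where "\<theta> t = \<sigma> * a t" for t
  define q where "q = \<sigma> *\<^sub>R r"
  have \<theta>_cont: "continuous_on S \<theta>" if "S \<subseteq> {0..1}" for S
    unfolding \<theta>_def using continuous_on_subset[OF a_cont that] by (intro continuous_intros)
  have \<theta>0: "\<theta> 0 = 0" by (simp add: \<theta>_def a0)
  have \<beta>\<theta>: "\<beta> t = cos (2 * pi * \<theta> t) *\<^sub>R p + sin (2 * pi * \<theta> t) *\<^sub>R q" if "t \<in> {0..1}" for t
    using \<beta>a[OF that] by (auto simp: \<theta>_def q_def \<sigma>_def)
  have not_int: "\<theta> t \<noteq> of_int n" if t: "t \<in> {0<..<1}" for t n
  proof
    assume "\<theta> t = of_int n"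
    then have "cos (2 * pi * \<theta> t) = 1" "sin (2 * pi * \<theta> t) = 0"
      using cos_int_2pin[of n] sin_int_2pin[of n] by (simp_all add: mult_ac)
    then have "\<beta> t = p"
      using \<beta>\<theta>[of t] t by simp
    with simple[OF t] show False by (simp add: p_def)
  qed
  have half: "\<theta> (1/2) > 0"
    using not_int[of "1/2" 0] by (auto simp: \<theta>_def \<sigma>_def)
  \<comment> \<open>\<open>b\<close> and \<open>c\<close> may be endpoints of the unit interval, but
    a value strictly between those at \<open>b\<close> and \<open>c\<close> is attained strictly
    between them, hence at an interior time, where \<open>not_int\<close> applies.\<close>
  have interior: "\<exists>u\<in>{0<..<1}. \<theta> u = y"
    if bc: "b \<in> {0..1}" "c \<in> {0..1}" and y: "\<theta> b < y" "y < \<theta> c" for b c y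
  proof -
    have seg: "closed_segment b c \<subseteq> {0..1}"
      using bc by (intro closed_segment_subset) auto
    then have "connected (\<theta> ` closed_segment b c)"
      by (intro connected_continuous_image \<theta>_cont) auto
    then have "y \<in> \<theta> ` closed_segment b c"
      by (rule connectedD_interval[of _ "\<theta> b" "\<theta> c"]) (use y in auto)
    then obtain u where u: "u \<in> closed_segment b c" "\<theta> u = y" by blast
    then have "u \<noteq> b" "u \<noteq> c" using y by blast+
    with u(1) have "u \<in> open_segment b c"
      by (simp add: open_segment_def)
    then have "u \<in> {0<..<1}"
      using bc by (auto simp: open_segment_eq_real_ivl split: if_splits)
    with u(2) show ?thesis by blast
  qed
  have range: "\<theta> t \<in> {0..1}" if t: "t \<in> {0..1}" for t
  proof -
    have "\<not> \<theta> t > 1"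
      using interior[of 0 t 1] t \<theta>0 not_int[of _ 1] by auto
    moreover have "\<not> \<theta> t < 0"
      using interior[of t "1/2" 0] t half not_int[of _ 0] by auto
    ultimately show ?thesis by simp
  qed
  have "\<theta> 1 = 0 \<or> \<theta> 1 = 1"
  proof -
    have "cos (2 * pi * \<theta> 1) *\<^sub>R p + sin (2 * pi * \<theta> 1) *\<^sub>R q = p"
      using \<beta>\<theta>[of 1] closed by (simp add: p_def)
    from arg_cong[OF this, of "\<lambda>v. v \<bullet> p"] have "cos (2 * pi * \<theta> 1) = 1"
      using r(2) unit[of 0] by (simp add: inner_add_left q_def inner_commute[of r] p_def norm_eq_1)
    then obtain n :: int where "2 * pi * \<theta> 1 = real_of_int n * 2 * pi"
      unfolding cos_one_2pi_int by blast
    then have "\<theta> 1 = real_of_int n" by simp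
    moreover from this have "0 \<le> n" "n \<le> 1" using range[of 1] by simp_all
    then have "n = 0 \<or> n = 1" by linarith
    ultimately show ?thesis by auto
  qed
  moreover have "norm q = 1" "\<beta> 0 \<bullet> q = 0"
    using r by (simp_all add: q_def \<sigma>_def p_def)
  moreover have "\<theta> ` {0..1} \<subseteq> {0..1}"
    using range by blast
  ultimately show ?thesis
    using that \<theta>_cont[OF order_refl] \<theta>0 \<beta>\<theta>[unfolded p_def] by blast
qed

text \<open>Projecting onto the nonzero velocity \<open>X'\<close> turns \<open>X\<close> into a
  real function with nonzero derivative at \<open>\<theta> t\<close>. Dividing the difference
  quotient of the projected \<open>c\<close> by the Caratheodory slope \<open>k\<close> gives that
  of \<open>\<theta>\<close>. Only continuity of \<open>\<theta>\<close> is presupposed, and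
  \<open>c'\<close> may vanish.\<close>

lemma lift_through_immersion_differentiable:
  fixes X :: "real \<Rightarrow> 'a::euclidean_space"
  assumes X: "(X has_vector_derivative X') (at (\<theta> t))" "X' \<noteq> 0"
    and \<theta>: "continuous_on S \<theta>" and t: "t \<in> S"
    and c: "(c has_vector_derivative c') (at t within S)" and eq: "\<And>t. t \<in> S \<Longrightarrow> c t = X (\<theta> t)"
  obtains d where "(\<theta> has_real_derivative d) (at t within S)"
proof -
  have "((\<lambda>\<tau>. X' \<bullet> X \<tau>) has_vector_derivative X' \<bullet> X') (at (\<theta> t))"
    by (rule bounded_linear.has_vector_derivative[OF bounded_linear_inner_right X(1)])
  then have "DERIV (\<lambda>\<tau>. X' \<bullet> X \<tau>) (\<theta> t) :> X' \<bullet> X'"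
    by (simp add: has_real_derivative_iff_has_vector_derivative)
  then obtain k where k: "\<And>\<tau>. X' \<bullet> X \<tau> - X' \<bullet> X (\<theta> t) = k \<tau> * (\<tau> - \<theta> t)"
    "isCont k (\<theta> t)" "k (\<theta> t) = X' \<bullet> X'"
    unfolding CARAT_DERIV by blast
  have k0: "k (\<theta> t) \<noteq> 0" using k(3) X(2) by simp
  have "((\<lambda>s. X' \<bullet> c s) has_vector_derivative X' \<bullet> c') (at t within S)"
    by (rule bounded_linear.has_vector_derivative[OF bounded_linear_inner_right c])
  then have u: "((\<lambda>s. (X' \<bullet> c s - X' \<bullet> c t) / (s - t)) \<longlongrightarrow> X' \<bullet> c') (at t within S)"
    by (simp add: has_field_derivative_iff flip: has_real_derivative_iff_has_vector_derivative)
  have "(\<theta> \<longlongrightarrow> \<theta> t) (at t within S)"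
    using \<theta> t by (auto simp: continuous_on_def)
  then have kt: "((\<lambda>s. k (\<theta> s)) \<longlongrightarrow> k (\<theta> t)) (at t within S)"
    by (rule isCont_tendsto_compose[OF k(2)])
  have "((\<lambda>s. (X' \<bullet> c s - X' \<bullet> c t) / (s - t) / k (\<theta> s)) \<longlongrightarrow> X' \<bullet> c' / k (\<theta> t)) (at t within S)"
    by (intro tendsto_divide u kt k0)
  moreover have "\<forall>\<^sub>F s in at t within S.
      (X' \<bullet> c s - X' \<bullet> c t) / (s - t) / k (\<theta> s) = (\<theta> s - \<theta> t) / (s - t)"
  proof -
    have "\<forall>\<^sub>F s in at t within S. k (\<theta> s) \<noteq> 0"
      using tendsto_imp_eventually_ne[OF kt k0] .
    moreover have "\<forall>\<^sub>F s in at t within S. s \<in> S"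
      by (auto simp: eventually_at_filter)
    ultimately show ?thesis
      by eventually_elim (simp add: eq t k(1))
  qed
  ultimately have "((\<lambda>s. (\<theta> s - \<theta> t) / (s - t)) \<longlongrightarrow> X' \<bullet> c' / k (\<theta> t)) (at t within S)"
    by (rule Lim_transform_eventually)
  then show ?thesis
    using that by (simp add: has_field_derivative_iff)
qed

lemma (in based_disk) boundary_deriv:
  "((\<lambda>t. \<phi> (circle t)) has_vector_derivative
     (circle' t $ 1 *\<^sub>R D 1 (circle t) + circle' t $ 2 *\<^sub>R D 2 (circle t))) (at t within S)"
  by (rule chain(1)[OF circle_deriv]) (use norm_circle U(2) in auto)

lemma (in based_disk) boundary_velocity_nonzero:
  assumes "inj (frechet_derivative \<phi> (at (circle t)))"
  shows "circle' t $ 1 *\<^sub>R D 1 (circle t) + circle' t $ 2 *\<^sub>R D 2 (circle t) \<noteq> 0"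
proof -
  have U: "circle t \<in> U" using norm_circle U(2) by auto
  have lin: "linear (frechet_derivative \<phi> (at (circle t)))"
    unfolding frechet_derivative_at[OF deriv_\<phi>[OF U], symmetric]
    by (rule has_derivative_linear[OF deriv_\<phi>[OF U]])
  have "((2 * pi) *\<^sub>R (a *\<^sub>R q0 - b *\<^sub>R p0)) \<bullet> ((2 * pi) *\<^sub>R (a *\<^sub>R q0 - b *\<^sub>R p0)) =
      (2 * pi) * (2 * pi) * (a * a + b * b)" for a b
    by (simp add: inner_diff_left inner_diff_right algebra_simps)
  from this[of "cos (2 * pi * t)" "sin (2 * pi * t)"]
  have "circle' t \<bullet> circle' t = (2 * pi) * (2 * pi)"
    by (simp add: circle'_def)
  then have "circle' t \<noteq> 0" by auto
  then have "frechet_derivative \<phi> (at (circle t)) (circle' t) \<noteq> 0"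
    using assms linear_injective_0[OF lin] by blast
  then show ?thesis
    by (simp add: frechet_derivative_at[OF deriv_\<phi>[OF U], symmetric])
qed

text \<open>The given lift is compared with the lift \<open>G\<close> of the circular boundary
  parametrization: pulled back along the angle function \<open>\<theta>\<close>, \<open>G\<close>
  solves the same linear equation as \<open>\<Gamma>\<close>, so both have the same end
  point.\<close>

theorem theorem0p1:
  fixes S :: "(real^('n::finite option)) set"
    and \<phi> :: "real^2 \<Rightarrow> real^('n option)"
    and \<gamma> :: "real \<Rightarrow> real^('n option)"
    and \<Gamma> :: "real \<Rightarrow> real^('n option)^('n option)"
  assumes "CARD('n) \<ge> 2"
    and "S \<subseteq> hyperbolic_space"
    and "disk_diffeo \<phi> S"
    and "proj (mat 1) \<in> \<phi> ` sphere 0 1"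
    and "C1_curve \<gamma>"
    and "simple_path \<gamma>"
    and "pathstart \<gamma> = proj (mat 1)" and "pathfinish \<gamma> = proj (mat 1)"
    and "path_image \<gamma> = \<phi> ` sphere 0 1"
    and "horizontal_lift \<Gamma> \<gamma>" and "\<Gamma> 0 = mat 1"
  shows "\<exists>f. C1_curve f \<and> (\<forall>t\<in>{0..1}. f t \<in> SOn) \<and> f 0 = mat 1 \<and>
           f 1 = matrix_inv (f 0) ** f 1 \<and>
           matrix_inv (f 0) ** f 1 = matrix_inv (\<Gamma> 0) ** \<Gamma> 1 \<and>
           curve_length f = disk_area \<phi>"
proof -
  obtain U where U: "open U" "cball 0 1 \<subseteq> U" "smooth_on \<phi> U"
    and bij: "bij_betw \<phi> (cball 0 1) S"
    and imm: "\<And>p. p \<in> cball 0 1 \<Longrightarrow> inj (frechet_derivative \<phi> (at p))"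
    using assms(3) unfolding disk_diffeo_def by blast
  have inj: "inj_on \<phi> (cball 0 1)" and img: "\<phi> ` cball 0 1 = S"
    using bij by (auto simp: bij_betw_def)
  have e0: "proj (mat 1) = (axis None 1 :: real^('n option))"
    by (simp add: proj_def)
  \<comment> \<open>The boundary curve is pulled back to the unit circle; continuity of the inverse
    of \<open>\<phi>\<close> comes from compactness of the disk.\<close>
  define \<beta> where "\<beta> t = inv_into (cball 0 1) \<phi> (\<gamma> t)" for t
  have \<gamma>_sphere: "\<gamma> t \<in> \<phi> ` sphere 0 1" if "t \<in> {0..1}" for t
    using assms(9) that by (auto simp: path_image_def)
  have \<beta>: "norm (\<beta> t) = 1" "\<phi> (\<beta> t) = \<gamma> t" if "t \<in> {0..1}" for t
  proof -
    obtain p where p: "\<gamma> t = \<phi> p" "norm p = 1" using \<gamma>_sphere[OF \<open>t \<in> {0..1}\<close>] by auto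
    then have "\<beta> t = p" using inv_into_f_f[OF inj, of p] by (simp add: \<beta>_def)
    with p show "norm (\<beta> t) = 1" "\<phi> (\<beta> t) = \<gamma> t" by auto
  qed
  have "\<phi> differentiable at p" if "p \<in> U" for p
    using U(3)[unfolded smooth_on_def, rule_format, of "Suc 0"] that by simp
  then have "continuous_on (cball 0 1) \<phi>"
    using U(2) by (intro continuous_at_imp_continuous_on ballI differentiable_imp_continuous_within) auto
  then have "continuous_on (\<phi> ` cball 0 1) (inv_into (cball 0 1) \<phi>)"
    by (rule continuous_on_inv) (use inj in auto)
  moreover have "continuous_on {0..1} \<gamma>"
    using assms(6) by (simp add: simple_path_def path_def)
  moreover have "\<gamma> ` {0..1} \<subseteq> \<phi> ` cball 0 1"
    using \<gamma>_sphere sphere_cball by blast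
  ultimately have \<beta>_cont: "continuous_on {0..1} \<beta>"
    unfolding \<beta>_def by (rule continuous_on_compose2)
  have \<gamma>01: "\<gamma> 0 = axis None 1" "\<gamma> 1 = axis None 1"
    using assms(7,8) by (simp_all add: pathstart_def pathfinish_def e0)
  have \<beta>_simple: "\<beta> t \<noteq> \<beta> 0" if "t \<in> {0<..<1}" for t
  proof
    assume "\<beta> t = \<beta> 0"
    then have "\<gamma> t = \<gamma> 0"
      using \<beta>(2)[of t] \<beta>(2)[of 0] that by simp
    with assms(6) that show False
      unfolding simple_path_def loop_free_def by force
  qed
  have "\<beta> 1 = \<beta> 0" by (simp add: \<beta>_def \<gamma>01)
  obtain q \<theta> where q: "norm q = 1" "\<beta> 0 \<bullet> q = 0" and \<theta>: "continuous_on {0..1} \<theta>" "\<theta> ` {0..1} \<subseteq> {0..1}"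
    "\<theta> 0 = 0" "\<theta> 1 = 0 \<or> \<theta> 1 = 1"
    and \<beta>\<theta>: "\<And>t. t \<in> {0..1} \<Longrightarrow> \<beta> t = cos (2 * pi * \<theta> t) *\<^sub>R \<beta> 0 + sin (2 * pi * \<theta> t) *\<^sub>R q"
    by (rule simple_circle_lift[OF \<beta>_cont \<beta>(1) \<beta>_simple \<open>\<beta> 1 = \<beta> 0\<close>]) blast+
  interpret disk: based_disk \<phi> U "\<beta> 0" q
    by unfold_locales (use U q \<beta>[of 0] \<gamma>01 img assms(2) in auto)
  define v where "v \<tau> = disk.circle' \<tau> $ 1 *\<^sub>R disk.D 1 (disk.circle \<tau>) + disk.circle' \<tau> $ 2 *\<^sub>R disk.D 2 (disk.circle \<tau>)" for \<tau>
  have \<gamma>\<theta>: "\<gamma> t = \<phi> (disk.circle (\<theta> t))" if "t \<in> {0..1}" for t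
    using \<beta>(2)[OF that] \<beta>\<theta>[OF that] by (simp add: disk.circle_def)
  obtain G f where G: "G 0 = mat 1"
    "\<And>t. t \<in> {0..1} \<Longrightarrow> (G has_vector_derivative minkowski_wedge (\<phi> (disk.circle t)) (v t) ** G t) (at t within {0..1})"
    and f: "C1_curve f" "\<And>t. t \<in> {0..1} \<Longrightarrow> f t \<in> SOn" "f 0 = mat 1" "f 1 = G 1"
    "curve_length f = disk_area \<phi>"
    by (rule disk.holonomy_curve[OF assms(1)]) (auto simp: v_def)
  obtain V where V: "\<And>t. t \<in> {0..1} \<Longrightarrow> V t \<in> horizontal_space (\<Gamma> t)"
    "\<And>t. t \<in> {0..1} \<Longrightarrow> (\<Gamma> has_vector_derivative V t) (at t within {0..1})"
    and \<Gamma>: "\<And>t. t \<in> {0..1} \<Longrightarrow> \<Gamma> t \<in> SO1n" "\<And>t. t \<in> {0..1} \<Longrightarrow> proj (\<Gamma> t) = \<gamma> t"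
    using assms(10) unfolding horizontal_lift_def by metis
  have \<gamma>_deriv: "(\<gamma> has_vector_derivative proj (V t)) (at t within {0..1})" if t: "t \<in> {0..1}" for t
  proof -
    have "((\<lambda>t. \<Gamma> t *v axis None 1) has_vector_derivative V t *v axis None 1) (at t within {0..1})"
      by (rule bounded_linear.has_vector_derivative[OF matrix_vector.bounded_linear_left V(2)[OF t]])
    then show ?thesis
      unfolding proj_def
      by (rule has_vector_derivative_transform[OF t, rotated]) (use \<Gamma>(2) in \<open>simp add: proj_def\<close>)
  qed
  \<comment> \<open>The coefficient is linear in the velocity, so a reparametrization merely
    multiplies it by the derivative \<open>d\<close> of \<open>\<theta>\<close>, the same factor
    that the chain rule puts in front of the derivative of \<open>G\<close>.\<close>
  have "\<Gamma> 1 = G (\<theta> 1)"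
  proof (rule ode_unique[where P = "\<lambda>t. minkowski_wedge (\<gamma> t) (proj (V t))" and Z = "\<lambda>t. G (\<theta> t)"])
    fix t :: real assume t: "t \<in> {0..1}"
    show "(\<Gamma> has_vector_derivative minkowski_wedge (\<gamma> t) (proj (V t)) ** \<Gamma> t) (at t within {0..1})"
      using V(2)[OF t] horizontal_space_wedge[OF _ V(1)[OF t]] \<Gamma>[OF t] SO1n_subset by auto
    have \<theta>t: "\<theta> t \<in> {0..1}" using \<theta>(2) t by blast
    have "disk.circle (\<theta> t) \<in> cball 0 1" using disk.norm_circle by simp
    then have "v (\<theta> t) \<noteq> 0"
      unfolding v_def by (intro disk.boundary_velocity_nonzero imm)
    then obtain d where d: "(\<theta> has_real_derivative d) (at t within {0..1})"
      using lift_through_immersion_differentiable[OF disk.boundary_deriv[folded v_def] _ \<theta>(1) t \<gamma>_deriv[OF t] \<gamma>\<theta>]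
      by blast
    then have d': "(\<theta> has_vector_derivative d) (at t within {0..1})"
      by (simp add: has_real_derivative_iff_has_vector_derivative)
    have "(((\<lambda>\<tau>. \<phi> (disk.circle \<tau>)) \<circ> \<theta>) has_vector_derivative d *\<^sub>R v (\<theta> t)) (at t within {0..1})"
      by (rule vector_diff_chain_within[OF d' disk.boundary_deriv[folded v_def]])
    then have "(\<gamma> has_vector_derivative d *\<^sub>R v (\<theta> t)) (at t within {0..1})"
      by (rule has_vector_derivative_transform[OF t, rotated]) (simp add: \<gamma>\<theta>)
    then have vt: "proj (V t) = d *\<^sub>R v (\<theta> t)"
      using has_vector_derivative_unique_unit_interval[OF \<gamma>_deriv[OF t] _ t] by blast
    have "((G \<circ> \<theta>) has_vector_derivative d *\<^sub>R (minkowski_wedge (\<phi> (disk.circle (\<theta> t))) (v (\<theta> t)) ** G (\<theta> t))) (at t within {0..1})"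
      by (rule vector_diff_chain_within[OF d' has_vector_derivative_within_subset[OF G(2)[OF \<theta>t] \<theta>(2)]])
    then show "((\<lambda>t. G (\<theta> t)) has_vector_derivative minkowski_wedge (\<gamma> t) (proj (V t)) ** G (\<theta> t)) (at t within {0..1})"
      by (simp add: o_def vt \<gamma>\<theta>[OF t] minkowski_wedge.scaleR_right matrix_mult.scaleR_left)
  qed (use assms(11) G(1) \<theta>(3) in \<open>auto simp: minkowski_adjoint_wedge\<close>)
  moreover have inv1: "matrix_inv (mat 1 :: real^('n option)^('n option)) = mat 1"
    by (simp add: matrix_inv_eq_adjoint mat1_O1n minkowski_adjoint_mat_1)
  moreover have "\<exists>f. C1_curve f \<and> (\<forall>t\<in>{0..1}. f t \<in> SOn) \<and> f 0 = mat 1 \<and> f 1 = G (\<theta> 1) \<and>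
      curve_length f = disk_area \<phi>"
  proof (cases "\<theta> 1 = 1")
    case True
    then show ?thesis using f by auto
  next
    \<comment> \<open>Here \<open>\<theta> 1 = 0\<close>, so the holonomy is the identity, and
      lengthening the constant curve to a closed one of the required length suffices.\<close>
    case False
    then have "G (\<theta> 1) = mat 1" using \<theta>(4) G(1) by auto
    have one: "mat 1 \<in> (SOn :: (real^('n option)^('n option)) set)"
      using f(2)[of 0] f(3) by simp
    obtain f' :: "real \<Rightarrow> real^('n option)^('n option)" where
      "C1_curve f'" "\<And>t. t \<in> {0..1} \<Longrightarrow> f' t \<in> SOn" "f' 0 = mat 1" "f' 1 = mat 1"
      "curve_length f' = disk_area \<phi>"
      by (rule lengthen_curve[OF assms(1), of "\<lambda>_. mat 1" "\<lambda>_. 0" "disk_area \<phi>"])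
        (use one disk.disk_area_nonneg in \<open>auto simp: matrix_mult.zero_right\<close>)
    then show ?thesis
      using \<open>G (\<theta> 1) = mat 1\<close> by auto
  qed
  ultimately show ?thesis
    using assms(11) by auto
qed

end
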